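(* Let $(M,F)$ be a Finsler manifold of dimension $n$ ($n\ge2$). If $F$ is of constant Ricci curvature and of constant S-curvature with respect to the Busemann-Hausdorff volume form $dV=dV_{BH}$, then the Berwald-Weyl curvature of $F$ with respect to $dV_{BH}$ (that is, of $(\mathbf{G}_F,dV_{BH})$) vanishes: $\mathbf{W}^{o}=0$.
   Context: Let $(x^i,y^i)$ be standard local coordinates on $TM$, $TM_0=TM\setminus\{0\}$; the summation convention is used and $f_{\cdot k}=\partial f/\partial y^k$. Spray: a smooth vector field on $TM_0$ of the local form $\mathbf{G}=y^{i}\frac{\partial}{\partial x^{i}}-2G^{i}\frac{\partial}{\partial y^{i}}$ with $G^i(x,\lambda y)=\lambda^2G^i(x,y)$ for all $\lambda>0$. Put $N^i_j=\partial G^i/\partial y^j$, $\Gamma^i_{jk}=\partial^2G^i/\partial y^j\partial y^k$ (Berwald connection), $\frac{\delta}{\delta x^k}=\frac{\partial}{\partial x^k}-N^l_k\frac{\partial}{\partial y^l}$. The horizontal covariant derivative with respect to $\mathbf{G}$ is that of the Berwald connection: $f_{|k}=\frac{\delta f}{\delta x^k}$, $A_{k|m}=\frac{\delta A_k}{\delta x^m}-\Gamma^l_{km}A_l$. Curvatures: $R^{i}_{~k}=2\frac{\partial G^{i}}{\partial x^{k}}-y^{j}\frac{\partial^{2} G^{i}}{\partial x^{j}\partial y^{k}}+2G^{j}\frac{\partial^{2} G^{i}}{\partial y^{j}\partial y^{k}}-\frac{\partial G^{i}}{\partial y^{s}}\frac{\partial G^{s}}{\partial y^{k}}$; Ricci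 curvature $\mathbf{Ric}_{G}=R^m_{~m}$; Ricci scalar $R=\frac{1}{n-1}\mathbf{Ric}_G$. For a volume form $dV=\sigma(x)dx^1\cdots dx^n$ ($\sigma>0$), the S-curvature of $(\mathbf{G},dV)$ is $\mathbf{S}=\frac{\partial G^m}{\partial y^m}-y^m\frac{\partial}{\partial x^m}(\ln\sigma)$. The associated projective spray $\hat{\mathbf{G}}$ has coefficients $\hat G^i=G^i-\frac{\mathbf{S}}{n+1}y^i$. Let $\hat R=\frac1{n-1}\mathbf{Ric}_{\hat G}$ be its Ricci scalar, and let $\parallel$ denote the horizontal covariant derivative with respect to $\hat{\mathbf{G}}$ (defined as $|$ with $\hat G^i$ in place of $G^i$). The Berwald-Weyl curvature $\mathbf{W}^o=W^o_kdx^k$ of $(\mathbf{G},dV)$ is $W^o_k=\hat R_{\parallel k}-\frac12\hat R_{\cdot k\parallel m}y^m$. Finsler metrics: a Finsler metric $F$ on $M$ is a function on $TM$, smooth and positive on $TM_0$, with $F(x,\lambda y)=\lambda F(x,y)$ for $\lambda>0$ and $(g_{ij})=(\frac12[F^2]_{y^iy^j})$ positive definite. It induces the spray $\mathbf{G}_F$ with $G^i=\frac14g^{il}\{[F^2]_{x^ky^l}y^k-[F^2]_{x^l}\}$. The Busemann-Hausdorff volume form is $dV_{BH}=\sigma_{BH}(x)dx^1\cdots dx^n$ with $\sigma_{BH}(x)=\mathrm{Vol}(\mathbb{B}^n(1))/\mathrm{Vol}\{(y^i)\in\mathbb{R}^n: F(x,y^i\partial_{x^i})<1\}$ (Euclidean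 volumes). $F$ is of constant S-curvature (w.r.t. $dV_{BH}$) if $\mathbf{S}=(n+1)cF$ for a constant $c$, where $\mathbf{S}$ is the S-curvature of $(\mathbf{G}_F,dV_{BH})$. $F$ is of constant Ricci curvature if $\mathbf{Ric}=(n-1)\sigma F^2$ for a constant $\sigma$, where $\mathbf{Ric}$ is the Ricci curvature of $\mathbf{G}_F$. *)

theory Defs
  imports "HOL-Analysis.Analysis"
begin

fun Ck_on :: "nat \<Rightarrow> ('a::euclidean_space \<Rightarrow> 'b::real_normed_vector) \<Rightarrow> 'a set \<Rightarrow> bool" where
  "Ck_on 0 f S \<longleftrightarrow> continuous_on S f"
| "Ck_on (Suc k) f S \<longleftrightarrow> (\<forall>x\<in>S. f differentiable (at x)) \<and>
     (\<forall>v. Ck_on k (\<lambda>x. frechet_derivative f (at x) v) S)"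

text \<open>Meant for open sets \<open>S\<close>: the derivatives are taken with respect to the ambient space.\<close>
definition smooth_on :: "('a::euclidean_space \<Rightarrow> 'b::real_normed_vector) \<Rightarrow> 'a set \<Rightarrow> bool" where
  "smooth_on f S \<longleftrightarrow> (\<forall>k. Ck_on k f S)"

type_synonym ('a, 'n) chart = "'a set \<times> ('a \<Rightarrow> real ^ 'n)"

definition chart_image :: "('a, 'n::finite) chart \<Rightarrow> (real ^ 'n) set" where
  "chart_image c = snd c ` fst c"

definition chart_inv :: "('a, 'n::finite) chart \<Rightarrow> real ^ 'n \<Rightarrow> 'a" where
  "chart_inv c = inv_into (fst c) (snd c)"

text \<open>The atlas \<open>A\<close> need not be maximal; the dimension is \<open>CARD('n)\<close>.\<close>
definition smooth_manifold :: "'a topology \<Rightarrow> ('a, 'n::finite) chart set \<Rightarrow> bool" where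
  "smooth_manifold M A \<longleftrightarrow>
     Hausdorff_space M \<and> second_countable M \<and>
     (\<Union>c\<in>A. fst c) = topspace M \<and>
     (\<forall>c\<in>A. openin M (fst c) \<and> open (chart_image c) \<and>
        homeomorphic_map (subtopology M (fst c)) (top_of_set (chart_image c)) (snd c)) \<and>
     (\<forall>c\<in>A. \<forall>d\<in>A. smooth_on (snd d \<circ> chart_inv c) (snd c ` (fst c \<inter> fst d)))"

text \<open>A tangent vector at \<open>p\<close> is the family of its component vectors with respect to all charts
  around \<open>p\<close>, subject to the usual transformation law (and \<open>0\<close> for the other arguments).\<close>
type_synonym ('a, 'n) tvector = "('a, 'n) chart \<Rightarrow> real ^ 'n"

definition tangent_space :: "('a, 'n::finite) chart set \<Rightarrow> 'a \<Rightarrow> ('a, 'n) tvector set" where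
  "tangent_space A p =
     {v. (\<forall>c\<in>A. \<forall>d\<in>A. p \<in> fst c \<and> p \<in> fst d \<longrightarrow>
            v d = frechet_derivative (snd d \<circ> chart_inv c) (at (snd c p)) (v c)) \<and>
         (\<forall>c. \<not> (c \<in> A \<and> p \<in> fst c) \<longrightarrow> v c = 0)}"

text \<open>The tangent vector \<open>y\<^sup>i \<partial>/\<partial>x\<^sup>i\<close> at \<open>p\<close> in the coordinates of the chart \<open>c\<close>:
  by the chain rule, the element of \<open>tangent_space A p\<close> whose component vector in \<open>c\<close> is \<open>y\<close>.\<close>
definition coord_vector ::
  "('a, 'n::finite) chart set \<Rightarrow> ('a, 'n) chart \<Rightarrow> 'a \<Rightarrow> real ^ 'n \<Rightarrow> ('a, 'n) tvector" where
  "coord_vector A c p y = (\<lambda>d. if d \<in> A \<and> p \<in> fst d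
     then frechet_derivative (snd d \<circ> chart_inv c) (at (snd c p)) y else 0)"

text \<open>Coordinate expression of a function on \<open>TM\<close>.\<close>
definition local_rep ::
  "('a, 'n::finite) chart set \<Rightarrow> ('a, 'n) chart \<Rightarrow> ('a \<Rightarrow> ('a, 'n) tvector \<Rightarrow> real)
     \<Rightarrow> (real ^ 'n) \<times> (real ^ 'n) \<Rightarrow> real" where
  "local_rep A c F = (\<lambda>(x, y). F (chart_inv c x) (coord_vector A c (chart_inv c x) y))"

text \<open>The part of \<open>TM\<^sub>0\<close> over the domain of \<open>c\<close>, in coordinates.\<close>
definition slit :: "('a, 'n::finite) chart \<Rightarrow> ((real ^ 'n) \<times> (real ^ 'n)) set" where
  "slit c = chart_image c \<times> (UNIV - {0})"

text \<open>Points of \<open>TM\<close> are pairs \<open>(x, y)\<close>; spray coefficients are given as \<open>G i (x, y)\<close>.\<close>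
type_synonym 'n lfun = "(real ^ 'n) \<times> (real ^ 'n) \<Rightarrow> real"

definition ddx :: "'n::finite \<Rightarrow> 'n lfun \<Rightarrow> 'n lfun" where
  "ddx k f = (\<lambda>z. frechet_derivative f (at z) (axis k 1, 0))"

definition ddy :: "'n::finite \<Rightarrow> 'n lfun \<Rightarrow> 'n lfun" where
  "ddy k f = (\<lambda>z. frechet_derivative f (at z) (0, axis k 1))"

definition Ncoef :: "('n::finite \<Rightarrow> 'n lfun) \<Rightarrow> 'n \<Rightarrow> 'n \<Rightarrow> 'n lfun" where
  "Ncoef G i j = ddy j (G i)"

definition berwald :: "('n::finite \<Rightarrow> 'n lfun) \<Rightarrow> 'n \<Rightarrow> 'n \<Rightarrow> 'n \<Rightarrow> 'n lfun" where
  "berwald G i j k = ddy j (ddy k (G i))"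

definition delta :: "('n::finite \<Rightarrow> 'n lfun) \<Rightarrow> 'n \<Rightarrow> 'n lfun \<Rightarrow> 'n lfun" where
  "delta G k f = (\<lambda>z. ddx k f z - (\<Sum>l\<in>UNIV. Ncoef G l k z * ddy l f z))"

definition hcov_fun :: "('n::finite \<Rightarrow> 'n lfun) \<Rightarrow> 'n lfun \<Rightarrow> 'n \<Rightarrow> 'n lfun" where
  "hcov_fun G f k = delta G k f"

text \<open>\<open>hcov_form G A k m\<close> is \<open>A\<^bsub>k|m\<^esub>\<close>.\<close>
definition hcov_form ::
  "('n::finite \<Rightarrow> 'n lfun) \<Rightarrow> ('n \<Rightarrow> 'n lfun) \<Rightarrow> 'n \<Rightarrow> 'n \<Rightarrow> 'n lfun" where
  "hcov_form G A k m = (\<lambda>z. delta G m (A k) z - (\<Sum>l\<in>UNIV. berwald G l k m z * A l z))"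

definition riemann :: "('n::finite \<Rightarrow> 'n lfun) \<Rightarrow> 'n \<Rightarrow> 'n \<Rightarrow> 'n lfun" where
  "riemann G i k = (\<lambda>z. 2 * ddx k (G i) z
     - (\<Sum>j\<in>UNIV. snd z $ j * ddx j (ddy k (G i)) z)
     + 2 * (\<Sum>j\<in>UNIV. G j z * ddy j (ddy k (G i)) z)
     - (\<Sum>s\<in>UNIV. ddy s (G i) z * ddy k (G s) z))"

definition ricci :: "('n::finite \<Rightarrow> 'n lfun) \<Rightarrow> 'n lfun" where
  "ricci G = (\<lambda>z. \<Sum>m\<in>UNIV. riemann G m m z)"

definition ricci_scalar :: "('n::finite \<Rightarrow> 'n lfun) \<Rightarrow> 'n lfun" where
  "ricci_scalar G = (\<lambda>z. ricci G z / (real CARD('n) - 1))"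

text \<open>In the following definitions \<open>\<sigma>\<close> is the density of the volume form in the coordinates \<open>x\<close>.\<close>

definition S_curvature :: "('n::finite \<Rightarrow> 'n lfun) \<Rightarrow> (real ^ 'n \<Rightarrow> real) \<Rightarrow> 'n lfun" where
  "S_curvature G \<sigma> = (\<lambda>(x, y). (\<Sum>m\<in>UNIV. ddy m (G m) (x, y))
     - (\<Sum>m\<in>UNIV. y $ m * frechet_derivative (\<lambda>x. ln (\<sigma> x)) (at x) (axis m 1)))"

definition projective_spray ::
  "('n::finite \<Rightarrow> 'n lfun) \<Rightarrow> (real ^ 'n \<Rightarrow> real) \<Rightarrow> 'n \<Rightarrow> 'n lfun" where
  "projective_spray G \<sigma> i = (\<lambda>z. G i z - S_curvature G \<sigma> z / (real CARD('n) + 1) * snd z $ i)"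

definition berwald_weyl ::
  "('n::finite \<Rightarrow> 'n lfun) \<Rightarrow> (real ^ 'n \<Rightarrow> real) \<Rightarrow> 'n \<Rightarrow> 'n lfun" where
  "berwald_weyl G \<sigma> k =
     (let H = projective_spray G \<sigma>; R = ricci_scalar H
      in (\<lambda>z. hcov_fun H R k z
            - 1 / 2 * (\<Sum>m\<in>UNIV. hcov_form H (\<lambda>j. ddy j R) k m z * snd z $ m)))"

text \<open>Here \<open>F\<close> is the coordinate expression of a Finsler metric.\<close>

definition fundamental_tensor :: "'n lfun \<Rightarrow> (real ^ 'n) \<times> (real ^ 'n) \<Rightarrow> real ^ 'n::finite ^ 'n" where
  "fundamental_tensor F z = (\<chi> i j. 1 / 2 * ddy j (ddy i (\<lambda>w. (F w)\<^sup>2)) z)"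

definition finsler_spray :: "'n::finite lfun \<Rightarrow> 'n \<Rightarrow> 'n lfun" where
  "finsler_spray F i = (\<lambda>z. 1 / 4 * (\<Sum>l\<in>UNIV. matrix_inv (fundamental_tensor F z) $ i $ l *
     ((\<Sum>k\<in>UNIV. ddy l (ddx k (\<lambda>w. (F w)\<^sup>2)) z * snd z $ k) - ddx l (\<lambda>w. (F w)\<^sup>2) z)))"

definition sigma_BH :: "'n::finite lfun \<Rightarrow> real ^ 'n \<Rightarrow> real" where
  "sigma_BH F x = measure lebesgue (ball (0 :: real ^ 'n) 1) / measure lebesgue {y. F (x, y) < 1}"

text \<open>\<open>F p\<close> is only relevant on \<open>tangent_space A p\<close>. Scaling of tangent vectors is written out
  componentwise.\<close>
definition finsler_metric ::
  "'a topology \<Rightarrow> ('a, 'n::finite) chart set \<Rightarrow> ('a \<Rightarrow> ('a, 'n) tvector \<Rightarrow> real) \<Rightarrow> bool" where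
  "finsler_metric M A F \<longleftrightarrow>
     (\<forall>p\<in>topspace M. \<forall>v\<in>tangent_space A p.
        (\<forall>a>0. F p (\<lambda>c. a *\<^sub>R v c) = a * F p v) \<and> (v \<noteq> (\<lambda>c. 0) \<longrightarrow> F p v > 0)) \<and>
     (\<forall>c\<in>A. smooth_on (local_rep A c F) (slit c) \<and>
        (\<forall>z\<in>slit c. \<forall>u. u \<noteq> 0 \<longrightarrow> u \<bullet> (fundamental_tensor (local_rep A c F) z *v u) > 0))"

definition constant_ricci_curvature ::
  "('a, 'n::finite) chart set \<Rightarrow> ('a \<Rightarrow> ('a, 'n) tvector \<Rightarrow> real) \<Rightarrow> bool" where
  "constant_ricci_curvature A F \<longleftrightarrow> (\<exists>\<kappa>::real. \<forall>c\<in>A. \<forall>z\<in>slit c.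
     ricci (finsler_spray (local_rep A c F)) z = (real CARD('n) - 1) * \<kappa> * (local_rep A c F z)\<^sup>2)"

definition constant_S_curvature_BH ::
  "('a, 'n::finite) chart set \<Rightarrow> ('a \<Rightarrow> ('a, 'n) tvector \<Rightarrow> real) \<Rightarrow> bool" where
  "constant_S_curvature_BH A F \<longleftrightarrow> (\<exists>\<kappa>::real. \<forall>c\<in>A. \<forall>z\<in>slit c.
     S_curvature (finsler_spray (local_rep A c F)) (sigma_BH (local_rep A c F)) z
       = (real CARD('n) + 1) * \<kappa> * local_rep A c F z)"

end

theory Submission
  imports Defs
begin

text \<open>
  Write \<open>G\<close> for the spray of \<open>F\<close> and \<open>n\<close> for the dimension. Constant S-curvature means
  \<open>S = (n + 1) c F\<close>, so the associated projective spray is \<open>H\<^sup>i = G\<^sup>i - c F y\<^sup>i\<close>: the volume form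
  enters the Berwald-Weyl curvature through the constant \<open>c\<close>. The claim is then
  an identity between derivatives of \<open>F\<close>, which rests on three facts.

  A Finsler metric is horizontally constant for its own spray, \<open>F\<^bsub>|k\<^esub> = 0\<close>
  (\<open>hcov_fun_Fsq\<close>). This is a consequence of the equation
  \<open>2 [F\<^sup>2]\<^bsub>y\<^sup>i y\<^sup>l\<^esub> G\<^sup>i = [F\<^sup>2]\<^bsub>x\<^sup>k y\<^sup>l\<^esub> y\<^sup>k - [F\<^sup>2]\<^bsub>x\<^sup>l\<^esub>\<close> for the spray and of the homogeneity of \<open>F\<close>.

  A change \<open>H\<^sup>i = G\<^sup>i + P y\<^sup>i\<close> adds \<open>(n - 1) (P\<^sup>2 - P\<^bsub>|k\<^esub> y\<^sup>k)\<close> to the Ricci curvature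
  (\<open>ricci_projective_change\<close>). For \<open>P = - c F\<close> the covariant derivative vanishes, and a
  metric with \<open>Ric = (n - 1) \<kappa> F\<^sup>2\<close> gets the Ricci scalar \<open>(\<kappa> + c\<^sup>2) F\<^sup>2\<close> for \<open>H\<close>.

  The horizontal derivative of \<open>F\<close> with respect to \<open>H\<close> is \<open>2 c F F\<^bsub>\<cdot>k\<^esub>\<close>. For
  \<open>R = a F\<^sup>2\<close> this gives \<open>R\<^bsub>\<parallel>k\<^esub> = 4 a c F\<^sup>2 F\<^bsub>\<cdot>k\<^esub>\<close> and
  \<open>R\<^bsub>\<cdot>k\<parallel>m\<^esub> y\<^sup>m = 8 a c F\<^sup>2 F\<^bsub>\<cdot>k\<^esub>\<close>, and the two terms of the Weyl form cancel
  (\<open>weyl_form_vanishes\<close>).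

  All of this happens in one chart. The analytic input is the symmetry of second derivatives
  and Euler's identity for homogeneous functions; the transformation law of tangent
  vectors shows that the coordinate expression of \<open>F\<close> is homogeneous in \<open>y\<close>.
\<close>

section \<open>Smooth real functions on open sets\<close>

abbreviation dir_deriv :: "'a::euclidean_space \<Rightarrow> ('a \<Rightarrow> real) \<Rightarrow> 'a \<Rightarrow> real" where
  "dir_deriv v f \<equiv> \<lambda>z. frechet_derivative f (at z) v"

lemma frechet_derivative_eqI:
  "(f has_derivative f') (at z) \<Longrightarrow> frechet_derivative f (at z) v = f' v"
  by (metis frechet_derivative_at)

text \<open>The value of \<^const>\<open>frechet_derivative\<close> at a point where a function is not differentiable is some
  fixed choice that depends only on which linear maps are derivatives there. It is therefore a local
  quantity for all functions.\<close>
lemma dir_deriv_cong_open: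
  fixes f g :: "'a::euclidean_space \<Rightarrow> real"
  assumes "open S" "z \<in> S" "\<And>x. x \<in> S \<Longrightarrow> f x = g x"
  shows "dir_deriv v f z = dir_deriv v g z"
proof -
  have "(f has_derivative D) (at z) \<longleftrightarrow> (g has_derivative D) (at z)" for D
    using has_derivative_transform_within_open[OF _ assms(1,2)] assms(3) by metis
  then show ?thesis
    by (simp add: frechet_derivative_def)
qed

lemma differentiable_cong_open:
  fixes f g :: "'a::euclidean_space \<Rightarrow> real"
  assumes "open S" "z \<in> S" "\<And>x. x \<in> S \<Longrightarrow> f x = g x"
  shows "f differentiable (at z) \<longleftrightarrow> g differentiable (at z)"
  unfolding differentiable_def
  using has_derivative_transform_within_open[OF _ assms(1,2)] assms(3) by metis

lemma Ck_on_cong: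
  fixes f g :: "'a::euclidean_space \<Rightarrow> real"
  assumes "open S" "\<And>x. x \<in> S \<Longrightarrow> f x = g x"
  shows "Ck_on k f S \<longleftrightarrow> Ck_on k g S"
  using assms(2)
proof (induction k arbitrary: f g)
  case 0
  then show ?case by (simp cong: continuous_on_cong)
next
  case (Suc k)
  have "Ck_on k (dir_deriv v f) S \<longleftrightarrow> Ck_on k (dir_deriv v g) S" for v
    by (rule Suc.IH) (rule dir_deriv_cong_open[OF assms(1)], auto simp: Suc.prems)
  moreover have "f differentiable (at x) \<longleftrightarrow> g differentiable (at x)" if "x \<in> S" for x
    using differentiable_cong_open[OF assms(1) that Suc.prems] .
  ultimately show ?case by auto
qed

lemma Ck_on_Suc_imp: "Ck_on (Suc k) f S \<Longrightarrow> Ck_on k f S"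
proof (induction k arbitrary: f)
  case 0
  then show ?case
    by (auto intro!: continuous_at_imp_continuous_on differentiable_imp_continuous_within)
qed auto

lemma Ck_on_const: "Ck_on k (\<lambda>x. c) S"
  by (induction k arbitrary: c) auto

lemma frechet_has_derivative:
  "f differentiable (at z) \<Longrightarrow> (f has_derivative (\<lambda>v. frechet_derivative f (at z) v)) (at z)"
  using frechet_derivative_works by blast

lemma Ck_on_linear:
  fixes f :: "'a::euclidean_space \<Rightarrow> real"
  assumes "bounded_linear f"
  shows "Ck_on k f S"
proof (cases k)
  case 0
  then show ?thesis using linear_continuous_on[OF assms] by simp
next
  case (Suc m)
  have d: "(f has_derivative f) (at z)" for z
    by (rule bounded_linear_imp_has_derivative[OF assms])
  then have "dir_deriv v f = (\<lambda>z. f v)" for v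
    by (auto simp: frechet_derivative_eqI)
  then show ?thesis using d Suc by (auto simp: Ck_on_const differentiable_def)
qed

lemma dir_deriv_add:
  fixes f g :: "'a::euclidean_space \<Rightarrow> real"
  assumes "f differentiable (at z)" "g differentiable (at z)"
  shows "dir_deriv v (\<lambda>x. f x + g x) z = dir_deriv v f z + dir_deriv v g z"
  using frechet_derivative_eqI[OF has_derivative_add[OF
      frechet_has_derivative[OF assms(1)] frechet_has_derivative[OF assms(2)]]] .

lemma dir_deriv_mult:
  fixes f g :: "'a::euclidean_space \<Rightarrow> real"
  assumes "f differentiable (at z)" "g differentiable (at z)"
  shows "dir_deriv v (\<lambda>x. f x * g x) z = f z * dir_deriv v g z + dir_deriv v f z * g z"
  using frechet_derivative_eqI[OF has_derivative_mult[OF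
      frechet_has_derivative[OF assms(1)] frechet_has_derivative[OF assms(2)]]] .

lemma Ck_on_add:
  fixes f g :: "'a::euclidean_space \<Rightarrow> real"
  assumes "open S" "Ck_on k f S" "Ck_on k g S"
  shows "Ck_on k (\<lambda>x. f x + g x) S"
  using assms(2,3)
proof (induction k arbitrary: f g)
  case 0
  then show ?case by (simp add: continuous_on_add)
next
  case (Suc k)
  have "Ck_on k (dir_deriv v (\<lambda>x. f x + g x)) S" for v
  proof -
    have "Ck_on k (\<lambda>x. dir_deriv v f x + dir_deriv v g x) S"
      using Suc by auto
    moreover have "dir_deriv v (\<lambda>x. f x + g x) x = dir_deriv v f x + dir_deriv v g x" if "x \<in> S" for x
      using Suc.prems that by (intro dir_deriv_add) auto
    ultimately show ?thesis
      by (rule Ck_on_cong[OF assms(1), THEN iffD2, rotated])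
  qed
  then show ?case using Suc.prems by auto
qed

lemma Ck_on_mult:
  fixes f g :: "'a::euclidean_space \<Rightarrow> real"
  assumes "open S" "Ck_on k f S" "Ck_on k g S"
  shows "Ck_on k (\<lambda>x. f x * g x) S"
  using assms(2,3)
proof (induction k arbitrary: f g)
  case 0
  then show ?case by (simp add: continuous_on_mult)
next
  case (Suc k)
  have "Ck_on k (dir_deriv v (\<lambda>x. f x * g x)) S" for v
  proof -
    have "Ck_on k (\<lambda>x. f x * dir_deriv v g x + dir_deriv v f x * g x) S"
      using Suc.prems Ck_on_Suc_imp[OF Suc.prems(1)] Ck_on_Suc_imp[OF Suc.prems(2)]
      by (intro Ck_on_add[OF assms(1)] Suc.IH) auto
    moreover have "dir_deriv v (\<lambda>x. f x * g x) x = f x * dir_deriv v g x + dir_deriv v f x * g x" if "x \<in> S" for x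
      using Suc.prems that by (intro dir_deriv_mult) auto
    ultimately show ?thesis
      by (rule Ck_on_cong[OF assms(1), THEN iffD2, rotated])
  qed
  then show ?case using Suc.prems by auto
qed

lemma Ck_on_inverse:
  fixes f :: "'a::euclidean_space \<Rightarrow> real"
  assumes "open S" "Ck_on k f S" "\<And>x. x \<in> S \<Longrightarrow> f x \<noteq> 0"
  shows "Ck_on k (\<lambda>x. inverse (f x)) S"
  using assms(2)
proof (induction k)
  case 0
  then show ?case using assms(3) by (simp add: continuous_on_inverse)
next
  case (Suc k)
  have der: "((\<lambda>x. inverse (f x)) has_derivative
      (\<lambda>v. - (inverse (f z) * dir_deriv v f z * inverse (f z)))) (at z)" if "z \<in> S" for z
    using Suc.prems that assms(3) by (intro Deriv.has_derivative_inverse frechet_has_derivative) auto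
  have "Ck_on k (dir_deriv v (\<lambda>x. inverse (f x))) S" for v
  proof -
    have "Ck_on k (\<lambda>x. - 1 * (inverse (f x) * dir_deriv v f x * inverse (f x))) S"
      using Suc.prems Ck_on_Suc_imp[OF Suc.prems] Suc.IH Ck_on_const
      by (intro Ck_on_mult[OF assms(1)]) auto
    moreover have "dir_deriv v (\<lambda>x. inverse (f x)) x
        = - 1 * (inverse (f x) * dir_deriv v f x * inverse (f x))" if "x \<in> S" for x
      using frechet_derivative_eqI[OF der[OF that]] by simp
    ultimately show ?thesis
      by (rule Ck_on_cong[OF assms(1), THEN iffD2, rotated])
  qed
  then show ?case using der by (auto simp: differentiable_def)
qed

lemma smooth_on_cong:
  fixes f g :: "'a::euclidean_space \<Rightarrow> real"
  assumes "open S" "\<And>x. x \<in> S \<Longrightarrow> f x = g x"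
  shows "smooth_on f S \<longleftrightarrow> smooth_on g S"
  unfolding smooth_on_def by (intro all_cong1 Ck_on_cong[OF assms])

lemma smooth_on_const: "smooth_on (\<lambda>x. c) S"
  by (simp add: smooth_on_def Ck_on_const)

lemma smooth_on_linear:
  fixes f :: "'a::euclidean_space \<Rightarrow> real"
  shows "bounded_linear f \<Longrightarrow> smooth_on f S"
  by (simp add: smooth_on_def Ck_on_linear)

lemma smooth_on_add:
  fixes f g :: "'a::euclidean_space \<Rightarrow> real"
  shows "open S \<Longrightarrow> smooth_on f S \<Longrightarrow> smooth_on g S \<Longrightarrow> smooth_on (\<lambda>x. f x + g x) S"
  by (simp add: smooth_on_def Ck_on_add)

lemma smooth_on_mult:
  fixes f g :: "'a::euclidean_space \<Rightarrow> real"
  shows "open S \<Longrightarrow> smooth_on f S \<Longrightarrow> smooth_on g S \<Longrightarrow> smooth_on (\<lambda>x. f x * g x) S"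
  by (simp add: smooth_on_def Ck_on_mult)

lemma smooth_on_cmult:
  fixes f :: "'a::euclidean_space \<Rightarrow> real"
  shows "open S \<Longrightarrow> smooth_on f S \<Longrightarrow> smooth_on (\<lambda>x. c * f x) S"
  by (simp add: smooth_on_const smooth_on_mult)

lemma smooth_on_diff:
  fixes f g :: "'a::euclidean_space \<Rightarrow> real"
  assumes "open S" "smooth_on f S" "smooth_on g S"
  shows "smooth_on (\<lambda>x. f x - g x) S"
  using smooth_on_add[OF assms(1,2) smooth_on_cmult[OF assms(1,3), of "-1"]] by simp

lemma smooth_on_inverse:
  fixes f :: "'a::euclidean_space \<Rightarrow> real"
  shows "open S \<Longrightarrow> smooth_on f S \<Longrightarrow> (\<And>x. x \<in> S \<Longrightarrow> f x \<noteq> 0) \<Longrightarrow>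
    smooth_on (\<lambda>x. inverse (f x)) S"
  by (simp add: smooth_on_def Ck_on_inverse)

lemma smooth_on_sum:
  fixes f :: "'i \<Rightarrow> 'a::euclidean_space \<Rightarrow> real"
  assumes "open S" "\<And>i. i \<in> I \<Longrightarrow> smooth_on (f i) S"
  shows "smooth_on (\<lambda>x. \<Sum>i\<in>I. f i x) S"
  using assms(2)
  by (induction I rule: infinite_finite_induct) (auto intro: smooth_on_const smooth_on_add[OF assms(1)])

lemma smooth_on_prod:
  fixes f :: "'i \<Rightarrow> 'a::euclidean_space \<Rightarrow> real"
  assumes "open S" "\<And>i. i \<in> I \<Longrightarrow> smooth_on (f i) S"
  shows "smooth_on (\<lambda>x. \<Prod>i\<in>I. f i x) S"
  using assms(2)
  by (induction I rule: infinite_finite_induct) (auto intro: smooth_on_const smooth_on_mult[OF assms(1)])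

lemma smooth_on_differentiable:
  "smooth_on f S \<Longrightarrow> z \<in> S \<Longrightarrow> f differentiable (at z)"
  unfolding smooth_on_def by (metis Ck_on.simps(2))

lemma smooth_on_continuous: "smooth_on f S \<Longrightarrow> continuous_on S f"
  unfolding smooth_on_def by (metis Ck_on.simps(1))

lemma smooth_on_dir_deriv:
  "smooth_on f S \<Longrightarrow> smooth_on (\<lambda>z. frechet_derivative f (at z) v) S"
  unfolding smooth_on_def by (metis Ck_on.simps(2))

text \<open>The determinant is a polynomial in the entries; with Cramer's rule this makes the solution of a
  regular linear system with smooth coefficients smooth.\<close>
lemma smooth_on_det:
  fixes M :: "'i::finite \<Rightarrow> 'i \<Rightarrow> 'a::euclidean_space \<Rightarrow> real"
  assumes "open S" "\<And>i j. smooth_on (M i j) S"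
  shows "smooth_on (\<lambda>z. det (\<chi> i j. M i j z)) S"
  unfolding det_def using assms
  by (auto intro!: smooth_on_sum smooth_on_mult smooth_on_prod smooth_on_const)

lemma dir_deriv_sum:
  fixes f :: "'i \<Rightarrow> 'a::euclidean_space \<Rightarrow> real"
  assumes "\<And>i. i \<in> I \<Longrightarrow> f i differentiable (at z)"
  shows "dir_deriv v (\<lambda>x. \<Sum>i\<in>I. f i x) z = (\<Sum>i\<in>I. dir_deriv v (f i) z)"
  by (rule frechet_derivative_eqI) (auto intro!: has_derivative_sum frechet_has_derivative assms)

lemma dir_deriv_cmult:
  fixes f :: "'a::euclidean_space \<Rightarrow> real"
  assumes "f differentiable (at z)"
  shows "dir_deriv v (\<lambda>x. c * f x) z = c * dir_deriv v f z"
  using dir_deriv_mult[OF differentiable_const assms] by simp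

lemma dir_deriv_diff:
  fixes f g :: "'a::euclidean_space \<Rightarrow> real"
  assumes "f differentiable (at z)" "g differentiable (at z)"
  shows "dir_deriv v (\<lambda>x. f x - g x) z = dir_deriv v f z - dir_deriv v g z"
  using frechet_derivative_eqI[OF has_derivative_diff[OF
      frechet_has_derivative[OF assms(1)] frechet_has_derivative[OF assms(2)]]] .

section \<open>Symmetry of second derivatives\<close>

lemma has_real_derivative_along_line:
  fixes f :: "'a::euclidean_space \<Rightarrow> real"
  assumes "f differentiable (at (p + s *\<^sub>R v))"
  shows "((\<lambda>s. f (p + s *\<^sub>R v)) has_real_derivative dir_deriv v f (p + s *\<^sub>R v)) (at s)"
proof -
  have "((\<lambda>s. p + s *\<^sub>R v) has_derivative (\<lambda>h. h *\<^sub>R v)) (at s)"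
    by (auto intro!: derivative_eq_intros)
  from diff_chain_at[OF this frechet_has_derivative[OF assms]]
  have "((\<lambda>s. f (p + s *\<^sub>R v)) has_derivative (\<lambda>h. dir_deriv (h *\<^sub>R v) f (p + s *\<^sub>R v))) (at s)"
    by (simp add: o_def)
  moreover have "dir_deriv (h *\<^sub>R v) f (p + s *\<^sub>R v) = dir_deriv v f (p + s *\<^sub>R v) * h" for h
    using linear_frechet_derivative[OF assms] by (simp add: linear_cmul)
  ultimately show ?thesis
    by (simp add: has_field_derivative_def)
qed

text \<open>The mean value theorem, once in direction \<open>v\<close> and once in direction \<open>w\<close>, turns the second
  difference over a parallelogram into a mixed derivative at an intermediate point. The left-hand
  side is symmetric in \<open>v\<close> and \<open>w\<close>.\<close>
lemma second_difference_mean_value: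
  fixes f :: "'a::euclidean_space \<Rightarrow> real"
  assumes "smooth_on f S" "t > 0"
    and S: "\<And>s r. 0 \<le> s \<Longrightarrow> s \<le> t \<Longrightarrow> 0 \<le> r \<Longrightarrow> r \<le> t \<Longrightarrow> z + s *\<^sub>R v + r *\<^sub>R w \<in> S"
  shows "\<exists>s\<in>{0..t}. \<exists>r\<in>{0..t}.
    f (z + t *\<^sub>R v + t *\<^sub>R w) - f (z + t *\<^sub>R v) - f (z + t *\<^sub>R w) + f z
      = t * t * dir_deriv w (dir_deriv v f) (z + s *\<^sub>R v + r *\<^sub>R w)"
proof -
  have d1: "f differentiable (at x)" if "x \<in> S" for x
    using smooth_on_differentiable assms(1) that by blast
  have d2: "dir_deriv v f differentiable (at x)" if "x \<in> S" for x
    using smooth_on_differentiable[OF smooth_on_dir_deriv[OF assms(1)]] that by blast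
  have "((\<lambda>s. f (z + t *\<^sub>R w + s *\<^sub>R v) - f (z + s *\<^sub>R v)) has_real_derivative
      dir_deriv v f (z + t *\<^sub>R w + s *\<^sub>R v) - dir_deriv v f (z + s *\<^sub>R v)) (at s)"
    if "0 \<le> s" "s \<le> t" for s
    using that assms(2) S[of s t] S[of s 0]
    by (intro DERIV_diff has_real_derivative_along_line d1) (auto simp: algebra_simps)
  from MVT2[OF assms(2) this] obtain s where s: "0 < s" "s < t"
    "f (z + t *\<^sub>R w + t *\<^sub>R v) - f (z + t *\<^sub>R v) - (f (z + t *\<^sub>R w + 0 *\<^sub>R v) - f (z + 0 *\<^sub>R v))
       = (t - 0) * (dir_deriv v f (z + t *\<^sub>R w + s *\<^sub>R v) - dir_deriv v f (z + s *\<^sub>R v))"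
    by blast
  have "((\<lambda>r. dir_deriv v f ((z + s *\<^sub>R v) + r *\<^sub>R w)) has_real_derivative
      dir_deriv w (dir_deriv v f) ((z + s *\<^sub>R v) + r *\<^sub>R w)) (at r)"
    if "0 \<le> r" "r \<le> t" for r
    using that s S[of s r] by (intro has_real_derivative_along_line d2) auto
  from MVT2[OF assms(2) this] obtain r where r: "0 < r" "r < t"
    "dir_deriv v f ((z + s *\<^sub>R v) + t *\<^sub>R w) - dir_deriv v f ((z + s *\<^sub>R v) + 0 *\<^sub>R w)
       = (t - 0) * dir_deriv w (dir_deriv v f) ((z + s *\<^sub>R v) + r *\<^sub>R w)"
    by blast
  have "dir_deriv v f (z + t *\<^sub>R w + s *\<^sub>R v) - dir_deriv v f (z + s *\<^sub>R v)
      = t * dir_deriv w (dir_deriv v f) (z + s *\<^sub>R v + r *\<^sub>R w)"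
    using r(3) by (simp add: add_ac)
  with s(3) have "f (z + t *\<^sub>R v + t *\<^sub>R w) - f (z + t *\<^sub>R v) - f (z + t *\<^sub>R w) + f z
      = t * t * dir_deriv w (dir_deriv v f) (z + s *\<^sub>R v + r *\<^sub>R w)"
    by (simp add: add_ac)
  with s r show ?thesis
    by (intro bexI[of _ s] bexI[of _ r]) auto
qed

text \<open>The second difference is \<open>t\<^sup>2\<close> times either mixed derivative, each at a point that tends to \<open>z\<close>
  with \<open>t\<close>. If the two values at \<open>z\<close> differed, continuity would make the two expressions differ for
  small \<open>t\<close>.\<close>
theorem dir_deriv_commute:
  fixes f :: "'a::euclidean_space \<Rightarrow> real"
  assumes "open S" "smooth_on f S" "z \<in> S"
  shows "dir_deriv w (dir_deriv v f) z = dir_deriv v (dir_deriv w f) z"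
proof (rule ccontr)
  assume neq: "\<not> ?thesis"
  define A where "A = dir_deriv w (dir_deriv v f)"
  define B where "B = dir_deriv v (dir_deriv w f)"
  define e where "e = \<bar>A z - B z\<bar> / 2"
  have "e > 0" using neq by (simp add: e_def A_def B_def)
  have "isCont A z" "isCont B z"
    unfolding A_def B_def
    using smooth_on_continuous[OF smooth_on_dir_deriv[OF smooth_on_dir_deriv[OF assms(2)]]]
      assms(1,3) continuous_on_eq_continuous_at by blast+
  then obtain d1 d2 where d: "d1 > 0" "d2 > 0"
    "\<And>x. dist x z < d1 \<Longrightarrow> \<bar>A x - A z\<bar> < e" "\<And>x. dist x z < d2 \<Longrightarrow> \<bar>B x - B z\<bar> < e"
    using \<open>e > 0\<close> unfolding continuous_at_eps_delta dist_real_def by (metis)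
  obtain d3 where d3: "d3 > 0" "ball z d3 \<subseteq> S"
    using assms(1,3) openE by blast
  \<comment> \<open>With this \<open>t\<close> the parallelogram spanned by \<open>t v\<close> and \<open>t w\<close> at \<open>z\<close> lies in the ball of radius \<open>d\<close>.\<close>
  define d where "d = min d1 (min d2 d3)"
  define t where "t = d / (2 * (norm v + norm w + 1))"
  have "d > 0" using d d3 by (simp add: d_def)
  have nn: "norm v + norm w + 1 > 0"
    by (simp add: add_nonneg_pos)
  have "t > 0"
    unfolding t_def using \<open>d > 0\<close> nn by simp
  have near: "dist (z + s *\<^sub>R v + r *\<^sub>R w) z < d"
    if "0 \<le> s" "s \<le> t" "0 \<le> r" "r \<le> t" for s r
  proof -
    have "dist (z + s *\<^sub>R v + r *\<^sub>R w) z = norm (s *\<^sub>R v + r *\<^sub>R w)"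
      by (simp add: dist_norm add.assoc)
    also have "\<dots> \<le> s * norm v + r * norm w"
      using norm_triangle_ineq[of "s *\<^sub>R v" "r *\<^sub>R w"] that by simp
    also have "\<dots> \<le> t * norm v + t * norm w"
      using that by (intro add_mono mult_right_mono) auto
    also have "\<dots> \<le> t * (norm v + norm w + 1)"
      using \<open>t > 0\<close> by (simp add: algebra_simps)
    also have "\<dots> = d / 2"
      unfolding t_def using nn by (simp add: field_simps)
    finally show ?thesis using \<open>d > 0\<close> by simp
  qed
  have inS: "z + s *\<^sub>R v + r *\<^sub>R w \<in> S" if "0 \<le> s" "s \<le> t" "0 \<le> r" "r \<le> t" for s r
    using near[OF that] d3 by (auto simp: d_def dist_commute)
  obtain s r where sr: "s \<in> {0..t}" "r \<in> {0..t}"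
    "f (z + t *\<^sub>R v + t *\<^sub>R w) - f (z + t *\<^sub>R v) - f (z + t *\<^sub>R w) + f z
      = t * t * A (z + s *\<^sub>R v + r *\<^sub>R w)"
    unfolding A_def
    using second_difference_mean_value[OF assms(2) \<open>t > 0\<close> inS] by blast
  obtain s' r' where sr': "s' \<in> {0..t}" "r' \<in> {0..t}"
    "f (z + t *\<^sub>R w + t *\<^sub>R v) - f (z + t *\<^sub>R w) - f (z + t *\<^sub>R v) + f z
      = t * t * B (z + s' *\<^sub>R w + r' *\<^sub>R v)"
    unfolding B_def
    using second_difference_mean_value[OF assms(2) \<open>t > 0\<close>, of z w v] inS
    by (smt (verit) add.commute add.left_commute add.assoc)
  have swap: "z + t *\<^sub>R w + t *\<^sub>R v = z + t *\<^sub>R v + t *\<^sub>R w"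
    "z + s' *\<^sub>R w + r' *\<^sub>R v = z + r' *\<^sub>R v + s' *\<^sub>R w"
    by simp_all
  have "t * t * A (z + s *\<^sub>R v + r *\<^sub>R w) = t * t * B (z + r' *\<^sub>R v + s' *\<^sub>R w)"
    using sr(3) sr'(3)[unfolded swap] by linarith
  then have "A (z + s *\<^sub>R v + r *\<^sub>R w) = B (z + r' *\<^sub>R v + s' *\<^sub>R w)"
    using \<open>t > 0\<close> by simp
  moreover have "\<bar>A (z + s *\<^sub>R v + r *\<^sub>R w) - A z\<bar> < e" "\<bar>B (z + r' *\<^sub>R v + s' *\<^sub>R w) - B z\<bar> < e"
    using near[of s r] near[of r' s'] sr sr' by (auto intro!: d simp: d_def)
  ultimately have "\<bar>A z - B z\<bar> < 2 * e" by linarith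
  then show False by (simp add: e_def)
qed

section \<open>Coordinate derivatives and fibrewise homogeneity\<close>

text \<open>Homogeneity of degree \<open>d\<close> in the fibre variable \<open>y\<close>, expressed by Euler's identity. In this
  form it passes to derivatives by differentiating the identity, and it is applied below to
  contractions with \<open>y\<close>.\<close>
definition homogeneous_on :: "((real ^ 'n) \<times> (real ^ 'n)) set \<Rightarrow> real \<Rightarrow> 'n::finite lfun \<Rightarrow> bool" where
  "homogeneous_on S d f \<longleftrightarrow> (\<forall>z\<in>S. (\<Sum>l\<in>UNIV. snd z $ l * ddy l f z) = d * f z)"

lemma homogeneous_onD:
  "homogeneous_on S d f \<Longrightarrow> z \<in> S \<Longrightarrow> (\<Sum>l\<in>UNIV. snd z $ l * ddy l f z) = d * f z"
  by (simp add: homogeneous_on_def)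

lemma bounded_linear_fibre_coordinate:
  "bounded_linear (\<lambda>z :: 'a::real_normed_vector \<times> (real ^ 'n). snd z $ m)"
  by (rule bounded_linear_compose[OF bounded_linear_vec_nth bounded_linear_snd])

lemma smooth_on_fibre_coordinate:
  "smooth_on (\<lambda>z :: (real ^ 'n::finite) \<times> (real ^ 'n). snd z $ m) S"
  by (rule smooth_on_linear[OF bounded_linear_fibre_coordinate])

lemma ddy_fibre_coordinate: "ddy k (\<lambda>z. snd z $ m) z = (if m = k then 1 else 0)"
  unfolding ddy_def
  by (subst frechet_derivative_eqI[OF bounded_linear_imp_has_derivative[OF
          bounded_linear_fibre_coordinate]]) (auto simp: axis_def)

lemma ddx_fibre_coordinate: "ddx k (\<lambda>z. snd z $ m) z = 0"
  unfolding ddx_def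
  by (subst frechet_derivative_eqI[OF bounded_linear_imp_has_derivative[OF
          bounded_linear_fibre_coordinate]]) auto

context
  fixes S :: "((real ^ 'n::finite) \<times> (real ^ 'n)) set"
  assumes S: "open S"
begin

lemma ddx_cong_open: "(\<And>w. w \<in> S \<Longrightarrow> f w = g w) \<Longrightarrow> z \<in> S \<Longrightarrow> ddx k f z = ddx k g z"
  unfolding ddx_def by (rule dir_deriv_cong_open[OF S])

lemma ddy_cong_open: "(\<And>w. w \<in> S \<Longrightarrow> f w = g w) \<Longrightarrow> z \<in> S \<Longrightarrow> ddy k f z = ddy k g z"
  unfolding ddy_def by (rule dir_deriv_cong_open[OF S])

lemma smooth_on_ddx: "smooth_on f S \<Longrightarrow> smooth_on (ddx k f) S"
  and smooth_on_ddy: "smooth_on f S \<Longrightarrow> smooth_on (ddy k f) S"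
  unfolding ddx_def ddy_def by (rule smooth_on_dir_deriv; assumption)+

lemma ddx_add:
  "smooth_on f S \<Longrightarrow> smooth_on g S \<Longrightarrow> z \<in> S \<Longrightarrow> ddx k (\<lambda>w. f w + g w) z = ddx k f z + ddx k g z"
  and ddy_add:
  "smooth_on f S \<Longrightarrow> smooth_on g S \<Longrightarrow> z \<in> S \<Longrightarrow> ddy k (\<lambda>w. f w + g w) z = ddy k f z + ddy k g z"
  unfolding ddx_def ddy_def by (rule dir_deriv_add; metis smooth_on_differentiable)+

lemma ddy_diff:
  "smooth_on f S \<Longrightarrow> smooth_on g S \<Longrightarrow> z \<in> S \<Longrightarrow> ddy k (\<lambda>w. f w - g w) z = ddy k f z - ddy k g z"
  unfolding ddy_def by (rule dir_deriv_diff; metis smooth_on_differentiable)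

lemma ddx_mult:
  "smooth_on f S \<Longrightarrow> smooth_on g S \<Longrightarrow> z \<in> S \<Longrightarrow>
    ddx k (\<lambda>w. f w * g w) z = f z * ddx k g z + ddx k f z * g z"
  and ddy_mult:
  "smooth_on f S \<Longrightarrow> smooth_on g S \<Longrightarrow> z \<in> S \<Longrightarrow>
    ddy k (\<lambda>w. f w * g w) z = f z * ddy k g z + ddy k f z * g z"
  unfolding ddx_def ddy_def by (rule dir_deriv_mult; metis smooth_on_differentiable)+

lemma ddx_cmult: "smooth_on f S \<Longrightarrow> z \<in> S \<Longrightarrow> ddx k (\<lambda>w. c * f w) z = c * ddx k f z"
  and ddy_cmult: "smooth_on f S \<Longrightarrow> z \<in> S \<Longrightarrow> ddy k (\<lambda>w. c * f w) z = c * ddy k f z"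
  unfolding ddx_def ddy_def by (rule dir_deriv_cmult; metis smooth_on_differentiable)+

lemma ddx_sum:
  "(\<And>i. i \<in> I \<Longrightarrow> smooth_on (f i) S) \<Longrightarrow> z \<in> S \<Longrightarrow> ddx k (\<lambda>w. \<Sum>i\<in>I. f i w) z = (\<Sum>i\<in>I. ddx k (f i) z)"
  and ddy_sum:
  "(\<And>i. i \<in> I \<Longrightarrow> smooth_on (f i) S) \<Longrightarrow> z \<in> S \<Longrightarrow> ddy k (\<lambda>w. \<Sum>i\<in>I. f i w) z = (\<Sum>i\<in>I. ddy k (f i) z)"
  unfolding ddx_def ddy_def by (rule dir_deriv_sum; metis smooth_on_differentiable)+

lemma ddy_ddy_commute: "smooth_on f S \<Longrightarrow> z \<in> S \<Longrightarrow> ddy i (ddy j f) z = ddy j (ddy i f) z"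
  and ddx_ddy_commute: "smooth_on f S \<Longrightarrow> z \<in> S \<Longrightarrow> ddx i (ddy j f) z = ddy j (ddx i f) z"
  unfolding ddx_def ddy_def by (rule dir_deriv_commute[OF S]; assumption)+

text \<open>The extra term comes from the derivative of the factor \<open>y\<^sup>k\<close>.\<close>
lemma ddy_contraction:
  assumes "\<And>l. smooth_on (u l) S" "z \<in> S"
  shows "ddy k (\<lambda>w. \<Sum>l\<in>UNIV. snd w $ l * u l w) z = (\<Sum>l\<in>UNIV. snd z $ l * ddy k (u l) z) + u k z"
proof -
  have "ddy k (\<lambda>w. \<Sum>l\<in>UNIV. snd w $ l * u l w) z
      = (\<Sum>l\<in>UNIV. snd z $ l * ddy k (u l) z + (if l = k then u l z else 0))"
    using assms smooth_on_mult[OF S smooth_on_fibre_coordinate]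
    by (subst ddy_sum) (auto intro!: sum.cong simp: ddy_mult smooth_on_fibre_coordinate ddy_fibre_coordinate)
  then show ?thesis
    by (simp add: sum.distrib)
qed

text \<open>Differentiate Euler's identity: the factor \<open>y\<^sup>k\<close> contributes one more \<open>f\<^bsub>\<cdot>k\<^esub>\<close>, which lowers the
  degree by one, and the second derivatives commute.\<close>
lemma homogeneous_on_ddy:
  assumes "smooth_on f S" "homogeneous_on S d f"
  shows "homogeneous_on S (d - 1) (ddy k f)"
  unfolding homogeneous_on_def
proof
  fix z assume z: "z \<in> S"
  have "d * ddy k f z = ddy k (\<lambda>w. d * f w) z"
    using assms(1) z by (simp add: ddy_cmult)
  also have "\<dots> = ddy k (\<lambda>w. \<Sum>l\<in>UNIV. snd w $ l * ddy l f w) z"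
    using homogeneous_onD[OF assms(2)] z by (intro ddy_cong_open) auto
  also have "\<dots> = (\<Sum>l\<in>UNIV. snd z $ l * ddy k (ddy l f) z) + ddy k f z"
    using assms(1) z by (intro ddy_contraction smooth_on_ddy)
  finally show "(\<Sum>l\<in>UNIV. snd z $ l * ddy l (ddy k f) z) = (d - 1) * ddy k f z"
    using ddy_ddy_commute[OF assms(1) z, of k] by (simp add: algebra_simps)
qed

lemma homogeneous_on_ddx:
  assumes "smooth_on f S" "homogeneous_on S d f"
  shows "homogeneous_on S d (ddx k f)"
  unfolding homogeneous_on_def
proof
  fix z assume z: "z \<in> S"
  have "d * ddx k f z = ddx k (\<lambda>w. d * f w) z"
    using assms(1) z by (simp add: ddx_cmult)
  also have "\<dots> = ddx k (\<lambda>w. \<Sum>l\<in>UNIV. snd w $ l * ddy l f w) z"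
    using homogeneous_onD[OF assms(2)] z by (intro ddx_cong_open) auto
  also have "\<dots> = (\<Sum>l\<in>UNIV. snd z $ l * ddx k (ddy l f) z)"
    using assms z smooth_on_mult[OF S smooth_on_fibre_coordinate smooth_on_ddy]
    by (subst ddx_sum) (auto intro!: sum.cong
        simp: ddx_mult smooth_on_fibre_coordinate smooth_on_ddy ddx_fibre_coordinate)
  finally show "(\<Sum>l\<in>UNIV. snd z $ l * ddy l (ddx k f) z) = d * ddx k f z"
    using ddx_ddy_commute[OF assms(1) z, of k] by simp
qed

lemma homogeneous_on_mult:
  assumes "smooth_on f S" "smooth_on g S" "homogeneous_on S d f" "homogeneous_on S e g"
  shows "homogeneous_on S (d + e) (\<lambda>w. f w * g w)"
  unfolding homogeneous_on_def
proof
  fix z assume z: "z \<in> S"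
  have "(\<Sum>l\<in>UNIV. snd z $ l * ddy l (\<lambda>w. f w * g w) z)
      = f z * (\<Sum>l\<in>UNIV. snd z $ l * ddy l g z) + (\<Sum>l\<in>UNIV. snd z $ l * ddy l f z) * g z"
    using assms z by (simp add: ddy_mult sum_distrib_left sum_distrib_right sum.distrib algebra_simps)
  then show "(\<Sum>l\<in>UNIV. snd z $ l * ddy l (\<lambda>w. f w * g w) z) = (d + e) * (f z * g z)"
    using homogeneous_onD[OF assms(3) z] homogeneous_onD[OF assms(4) z] by (simp add: algebra_simps)
qed

lemma homogeneous_on_sum:
  assumes "\<And>i. i \<in> I \<Longrightarrow> smooth_on (f i) S" "\<And>i. i \<in> I \<Longrightarrow> homogeneous_on S d (f i)"
  shows "homogeneous_on S d (\<lambda>w. \<Sum>i\<in>I. f i w)"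
  unfolding homogeneous_on_def
proof
  fix z assume z: "z \<in> S"
  have "(\<Sum>l\<in>UNIV. snd z $ l * ddy l (\<lambda>w. \<Sum>i\<in>I. f i w) z)
      = (\<Sum>l\<in>UNIV. \<Sum>i\<in>I. snd z $ l * ddy l (f i) z)"
    using assms z by (simp add: ddy_sum sum_distrib_left)
  also have "\<dots> = (\<Sum>i\<in>I. \<Sum>l\<in>UNIV. snd z $ l * ddy l (f i) z)"
    by (rule sum.swap)
  also have "\<dots> = d * (\<Sum>i\<in>I. f i z)"
    using homogeneous_onD[OF assms(2) z] by (simp add: sum_distrib_left)
  finally show "(\<Sum>l\<in>UNIV. snd z $ l * ddy l (\<lambda>w. \<Sum>i\<in>I. f i w) z) = d * (\<Sum>i\<in>I. f i z)" .
qed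

lemma homogeneous_on_diff:
  assumes "smooth_on f S" "smooth_on g S" "homogeneous_on S d f" "homogeneous_on S d g"
  shows "homogeneous_on S d (\<lambda>w. f w - g w)"
  using homogeneous_onD[OF assms(3)] homogeneous_onD[OF assms(4)] assms(1,2)
  by (simp add: homogeneous_on_def ddy_diff algebra_simps sum_subtractf)

lemma homogeneous_on_cmult:
  "smooth_on f S \<Longrightarrow> homogeneous_on S d f \<Longrightarrow> homogeneous_on S d (\<lambda>w. c * f w)"
  by (simp add: homogeneous_on_def ddy_cmult algebra_simps flip: sum_distrib_left)

lemma homogeneous_on_cong:
  assumes "\<And>w. w \<in> S \<Longrightarrow> f w = g w"
  shows "homogeneous_on S d f \<longleftrightarrow> homogeneous_on S d g"
  using ddy_cong_open[OF assms] assms by (simp add: homogeneous_on_def)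

lemma homogeneous_on_fibre_coordinate: "homogeneous_on S 1 (\<lambda>z. snd z $ m)"
  by (simp add: homogeneous_on_def ddy_fibre_coordinate if_distrib cong: if_cong)

section \<open>Ricci curvature under a projective change\<close>

text \<open>The projective spray agrees with \<open>G\<^sup>i - c F y\<^sup>i\<close> only over the slit domain. Because derivatives are
  local, curvature and covariant derivatives there do not see the difference.\<close>
lemma ricci_cong_open:
  assumes "\<And>i w. w \<in> S \<Longrightarrow> G i w = H i w" "z \<in> S"
  shows "ricci G z = ricci H z"
proof -
  have y: "ddy k (G i) w = ddy k (H i) w" and x: "ddx k (G i) w = ddx k (H i) w"
    if "w \<in> S" for i k w
    using that assms(1) by (auto intro: ddy_cong_open ddx_cong_open)
  have "ddx j (ddy k (G i)) z = ddx j (ddy k (H i)) z"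
    "ddy j (ddy k (G i)) z = ddy j (ddy k (H i)) z" for i j k
    using assms(2) y by (auto intro: ddy_cong_open ddx_cong_open)
  then show ?thesis
    using assms x y by (simp add: ricci_def riemann_def)
qed

definition divergence :: "('n \<Rightarrow> 'n lfun) \<Rightarrow> 'n lfun" where
  "divergence G = (\<lambda>z. \<Sum>m\<in>UNIV. ddy m (G m) z)"

text \<open>In the trace of the Riemann curvature the second derivatives enter only through the function
  \<open>\<partial>G\<^sup>m/\<partial>y\<^sup>m\<close>, which changes in a simple way under a projective change.\<close>
lemma ricci_eq_divergence:
  assumes "\<And>i. smooth_on (G i) S" "z \<in> S"
  shows "ricci G z = 2 * (\<Sum>m\<in>UNIV. ddx m (G m) z) - (\<Sum>j\<in>UNIV. snd z $ j * ddx j (divergence G) z)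
     + 2 * (\<Sum>j\<in>UNIV. G j z * ddy j (divergence G) z)
     - (\<Sum>m\<in>UNIV. \<Sum>s\<in>UNIV. ddy s (G m) z * ddy m (G s) z)"
proof -
  have "(\<Sum>m\<in>UNIV. \<Sum>j\<in>UNIV. snd z $ j * ddx j (ddy m (G m)) z)
      = (\<Sum>j\<in>UNIV. snd z $ j * ddx j (divergence G) z)"
    unfolding divergence_def using assms
    by (subst sum.swap) (simp add: ddx_sum smooth_on_ddy sum_distrib_left)
  moreover have "(\<Sum>m\<in>UNIV. \<Sum>j\<in>UNIV. G j z * ddy j (ddy m (G m)) z)
      = (\<Sum>j\<in>UNIV. G j z * ddy j (divergence G) z)"
    unfolding divergence_def using assms
    by (subst sum.swap) (simp add: ddy_sum smooth_on_ddy sum_distrib_left)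
  ultimately show ?thesis
    by (simp add: ricci_def riemann_def sum.distrib sum_subtractf flip: sum_distrib_left)
qed

lemma smooth_on_projective_change:
  "smooth_on g S \<Longrightarrow> smooth_on P S \<Longrightarrow> smooth_on (\<lambda>w. g w + P w * snd w $ i) S"
  by (intro smooth_on_add smooth_on_mult S smooth_on_fibre_coordinate)

lemma homogeneous_on_projective_change:
  assumes "smooth_on g S" "smooth_on P S" "homogeneous_on S 2 g" "homogeneous_on S 1 P"
  shows "homogeneous_on S 2 (\<lambda>w. g w + P w * snd w $ i)"
proof -
  have s: "smooth_on (\<lambda>w. - 1 * (P w * snd w $ i)) S"
    using assms by (intro smooth_on_cmult smooth_on_mult S smooth_on_fibre_coordinate)
  have "homogeneous_on S 2 (\<lambda>w. g w - - 1 * (P w * snd w $ i))"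
    using assms homogeneous_on_mult[OF assms(2) smooth_on_fibre_coordinate assms(4)
        homogeneous_on_fibre_coordinate]
    by (intro homogeneous_on_diff s homogeneous_on_cmult smooth_on_mult S smooth_on_fibre_coordinate)
      auto
  then show ?thesis by simp
qed

lemma ddy_projective_change:
  "smooth_on g S \<Longrightarrow> smooth_on P S \<Longrightarrow> z \<in> S \<Longrightarrow>
    ddy k (\<lambda>w. g w + P w * snd w $ i) z
      = ddy k g z + ddy k P z * snd z $ i + (if i = k then P z else 0)"
  by (simp add: ddy_add ddy_mult smooth_on_mult[OF S] smooth_on_fibre_coordinate ddy_fibre_coordinate)

lemma ddx_projective_change:
  "smooth_on g S \<Longrightarrow> smooth_on P S \<Longrightarrow> z \<in> S \<Longrightarrow>
    ddx k (\<lambda>w. g w + P w * snd w $ i) z = ddx k g z + ddx k P z * snd z $ i"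
  by (simp add: ddx_add ddx_mult smooth_on_mult[OF S] smooth_on_fibre_coordinate ddx_fibre_coordinate)

text \<open>The term \<open>P y\<^sup>i\<close> contributes \<open>n P\<close> from \<open>\<partial>y\<^sup>i/\<partial>y\<^sup>i\<close> and one more \<open>P\<close> from Euler's identity.\<close>
lemma divergence_projective_change:
  assumes "\<And>i. smooth_on (G i) S" "smooth_on P S" "homogeneous_on S 1 P" "z \<in> S"
  shows "divergence (\<lambda>i w. G i w + P w * snd w $ i) z
    = divergence G z + (real CARD('n) + 1) * P z"
  using assms homogeneous_onD[OF assms(3,4)]
  by (simp add: divergence_def ddy_projective_change sum.distrib algebra_simps)

text \<open>The left-hand side is the trace of the square of \<open>N + y p\<^sup>T + q I\<close>, the matrix \<open>\<partial>H\<^sup>i/\<partial>y\<^sup>j\<close> of the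
  changed spray when \<open>p\<close> is the fibre gradient of \<open>P\<close> and \<open>q\<close> its value.\<close>
lemma square_trace_rank_one_update:
  fixes N :: "'n \<Rightarrow> 'n \<Rightarrow> real"
  shows "(\<Sum>m\<in>UNIV. \<Sum>s\<in>UNIV. (N m s + p s * y m + (if m = s then q else 0))
        * (N s m + p m * y s + (if s = m then q else 0)))
    = (\<Sum>m\<in>UNIV. \<Sum>s\<in>UNIV. N m s * N s m) + 2 * (\<Sum>m\<in>UNIV. p m * (\<Sum>s\<in>UNIV. y s * N m s))
      + (\<Sum>m\<in>UNIV. y m * p m)\<^sup>2 + 2 * q * (\<Sum>m\<in>UNIV. N m m) + 2 * q * (\<Sum>m\<in>UNIV. y m * p m)
      + real CARD('n) * q\<^sup>2"
proof -
  have e: "(N m s + p s * y m + (if m = s then q else 0)) * (N s m + p m * y s + (if s = m then q else 0))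
    = N m s * N s m + p m * (y s * N m s) + p s * (y m * N s m) + (y m * p m) * (y s * p s)
      + (if m = s then 2 * q * N m m + 2 * q * (y m * p m) + q\<^sup>2 else 0)" for m s
    by (auto simp: algebra_simps power2_eq_square)
  have sw: "(\<Sum>m\<in>UNIV. \<Sum>s\<in>UNIV. p s * (y m * N s m)) = (\<Sum>m\<in>UNIV. \<Sum>s\<in>UNIV. p m * (y s * N m s))"
    by (rule sum.swap)
  have sq: "(\<Sum>m\<in>UNIV. \<Sum>s\<in>UNIV. (y m * p m) * (y s * p s)) = (\<Sum>m\<in>UNIV. y m * p m)\<^sup>2"
    by (simp add: power2_eq_square sum_product)
  show ?thesis
    unfolding e sum.distrib sw sq by (simp add: sum.distrib sum_distrib_left algebra_simps)
qed

text \<open>Each of the four terms of the Ricci curvature is expanded separately; Euler's identity removes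
  all contractions with \<open>y\<close>. With \<open>q = y\<^sup>k \<partial>P/\<partial>x\<^sup>k\<close> and \<open>r = G\<^sup>k \<partial>P/\<partial>y\<^sup>k\<close>, the products of \<open>P\<close> with the
  divergence of \<open>G\<close> cancel, and \<open>q\<close> and \<open>r\<close> combine to \<open>P\<^bsub>|k\<^esub> y\<^sup>k = q - 2 r\<close>.\<close>
theorem ricci_projective_change:
  assumes G: "\<And>i. smooth_on (G i) S" "\<And>i. homogeneous_on S 2 (G i)"
    and P: "smooth_on P S" "homogeneous_on S 1 P" and z: "z \<in> S"
  shows "ricci (\<lambda>i w. G i w + P w * snd w $ i) z
    = ricci G z + (real CARD('n) - 1) * ((P z)\<^sup>2 - (\<Sum>k\<in>UNIV. snd z $ k * hcov_fun G P k z))"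
proof -
  let ?H = "\<lambda>i w. G i w + P w * snd w $ i"
  let ?n = "real CARD('n)"
  have sD: "smooth_on (divergence G) S"
    unfolding divergence_def by (intro smooth_on_sum smooth_on_ddy G S)
  have hD: "homogeneous_on S 1 (divergence G)"
    unfolding divergence_def
    using homogeneous_on_ddy[OF G] by (intro homogeneous_on_sum smooth_on_ddy G) auto
  have eP: "(\<Sum>l\<in>UNIV. snd z $ l * ddy l P z) = P z"
    using homogeneous_onD[OF P(2) z] by simp
  have eD: "(\<Sum>l\<in>UNIV. snd z $ l * ddy l (divergence G) z) = divergence G z"
    using homogeneous_onD[OF hD z] by simp
  have eG: "(\<Sum>l\<in>UNIV. snd z $ l * ddy l (G i) z) = 2 * G i z" for i
    using homogeneous_onD[OF G(2) z] by simp
  have xD: "ddx j (divergence ?H) z = ddx j (divergence G) z + (?n + 1) * ddx j P z" for j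
  proof -
    have "ddx j (divergence ?H) z = ddx j (\<lambda>w. divergence G w + (?n + 1) * P w) z"
      using z G P by (intro ddx_cong_open divergence_projective_change)
    then show ?thesis
      using z sD P by (simp add: ddx_add ddx_cmult smooth_on_cmult[OF S])
  qed
  have yD: "ddy j (divergence ?H) z = ddy j (divergence G) z + (?n + 1) * ddy j P z" for j
  proof -
    have "ddy j (divergence ?H) z = ddy j (\<lambda>w. divergence G w + (?n + 1) * P w) z"
      using z G P by (intro ddy_cong_open divergence_projective_change)
    then show ?thesis
      using z sD P by (simp add: ddy_add ddy_cmult smooth_on_cmult[OF S])
  qed
  define q where "q = (\<Sum>k\<in>UNIV. snd z $ k * ddx k P z)"
  define r where "r = (\<Sum>k\<in>UNIV. G k z * ddy k P z)"
  have T1: "(\<Sum>m\<in>UNIV. ddx m (?H m) z) = (\<Sum>m\<in>UNIV. ddx m (G m) z) + q"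
    using G P z by (simp add: ddx_projective_change sum.distrib q_def mult.commute)
  have T2: "(\<Sum>j\<in>UNIV. snd z $ j * ddx j (divergence ?H) z)
      = (\<Sum>j\<in>UNIV. snd z $ j * ddx j (divergence G) z) + (?n + 1) * q"
    unfolding xD q_def by (simp add: sum.distrib sum_distrib_left algebra_simps)
  have "(\<Sum>j\<in>UNIV. ?H j z * ddy j (divergence ?H) z)
      = (\<Sum>j\<in>UNIV. G j z * ddy j (divergence G) z) + (?n + 1) * r
        + P z * (\<Sum>j\<in>UNIV. snd z $ j * ddy j (divergence G) z)
        + (?n + 1) * P z * (\<Sum>j\<in>UNIV. snd z $ j * ddy j P z)"
    unfolding yD r_def by (simp add: sum.distrib sum_distrib_left algebra_simps)
  then have T3: "(\<Sum>j\<in>UNIV. ?H j z * ddy j (divergence ?H) z)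
      = (\<Sum>j\<in>UNIV. G j z * ddy j (divergence G) z) + (?n + 1) * r
        + P z * divergence G z + (?n + 1) * (P z)\<^sup>2"
    unfolding eP eD by (simp add: power2_eq_square)
  have T4: "(\<Sum>m\<in>UNIV. \<Sum>s\<in>UNIV. ddy s (?H m) z * ddy m (?H s) z)
      = (\<Sum>m\<in>UNIV. \<Sum>s\<in>UNIV. ddy s (G m) z * ddy m (G s) z) + 4 * r
        + 2 * P z * divergence G z + (?n + 3) * (P z)\<^sup>2"
  proof -
    have "(\<Sum>m\<in>UNIV. ddy m P z * (2 * G m z)) = 2 * r"
      by (simp add: r_def sum_distrib_left mult_ac)
    then show ?thesis
      unfolding ddy_projective_change[OF G(1) P(1) z] square_trace_rank_one_update eP eG
      by (simp add: divergence_def algebra_simps power2_eq_square)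
  qed
  have "(\<Sum>k\<in>UNIV. snd z $ k * hcov_fun G P k z)
      = q - (\<Sum>k\<in>UNIV. \<Sum>l\<in>UNIV. snd z $ k * (ddy k (G l) z * ddy l P z))"
    by (simp add: hcov_fun_def delta_def Ncoef_def q_def sum_subtractf algebra_simps sum_distrib_left)
  also have "(\<Sum>k\<in>UNIV. \<Sum>l\<in>UNIV. snd z $ k * (ddy k (G l) z * ddy l P z))
      = (\<Sum>l\<in>UNIV. (\<Sum>k\<in>UNIV. snd z $ k * ddy k (G l) z) * ddy l P z)"
    by (subst sum.swap) (simp add: sum_distrib_right mult.assoc)
  also have "\<dots> = 2 * r"
    unfolding eG by (simp add: r_def sum_distrib_left mult.assoc)
  finally have T5: "(\<Sum>k\<in>UNIV. snd z $ k * hcov_fun G P k z) = q - 2 * r" .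
  have sH: "smooth_on (?H i) S" for i
    by (intro smooth_on_projective_change G P)
  show ?thesis
    unfolding ricci_eq_divergence[OF sH z] ricci_eq_divergence[OF G(1) z] T1 T2 T3 T4 T5
    by (simp add: algebra_simps)
qed

section \<open>The Weyl one-form of a spray\<close>

text \<open>Fibre derivative and horizontal derivative commute up to the Berwald connection:
  \<open>(R\<^bsub>\<parallel>m\<^esub>)\<^bsub>\<cdot>k\<^esub> = R\<^bsub>\<cdot>k\<parallel>m\<^esub>\<close>. Hence the contraction is \<open>(R\<^bsub>\<parallel>m\<^esub> y\<^sup>m)\<^bsub>\<cdot>k\<^esub>\<close>, corrected by the derivative
  of the factor \<open>y\<^sup>m\<close>.\<close>
lemma hcov_form_gradient_along_fibre:
  assumes H: "\<And>i. smooth_on (H i) S" "\<And>i. homogeneous_on S 2 (H i)"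
    and R: "smooth_on R S" and z: "z \<in> S"
  shows "(\<Sum>m\<in>UNIV. hcov_form H (\<lambda>j. ddy j R) k m z * snd z $ m)
    = ddy k (\<lambda>w. \<Sum>m\<in>UNIV. snd w $ m * hcov_fun H R m w) z - hcov_fun H R k z"
proof -
  have eH: "(\<Sum>m\<in>UNIV. snd z $ m * ddy m (ddy k (H l)) z) = ddy k (H l) z" for l
    using homogeneous_onD[OF homogeneous_on_ddy[OF H] z] by simp
  have t: "ddy k (hcov_fun H R m) z = hcov_form H (\<lambda>j. ddy j R) k m z" for m
  proof -
    have "ddy k (hcov_fun H R m) z
      = ddy k (ddx m R) z - (\<Sum>l\<in>UNIV. ddy m (H l) z * ddy k (ddy l R) z + ddy k (ddy m (H l)) z * ddy l R z)"
      unfolding hcov_fun_def delta_def Ncoef_def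
      using H R z by (simp add: ddy_diff ddy_sum ddy_mult smooth_on_ddy smooth_on_ddx
          smooth_on_sum[OF S] smooth_on_mult[OF S])
    also have "\<dots> = hcov_form H (\<lambda>j. ddy j R) k m z"
      unfolding hcov_form_def delta_def Ncoef_def berwald_def
      using ddy_ddy_commute[OF R z, of k] ddx_ddy_commute[OF R z, of m k]
      by (simp add: sum.distrib)
    finally show ?thesis .
  qed
  have "ddy k (\<lambda>w. \<Sum>m\<in>UNIV. snd w $ m * hcov_fun H R m w) z
     = (\<Sum>m\<in>UNIV. snd z $ m * ddy k (hcov_fun H R m) z) + hcov_fun H R k z"
    using H R z unfolding hcov_fun_def delta_def Ncoef_def
    by (intro ddy_contraction smooth_on_diff smooth_on_ddx smooth_on_sum smooth_on_mult smooth_on_ddy S)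
  then show ?thesis
    unfolding t by (simp add: mult.commute)
qed

lemma hcov_fun_cmult_square:
  assumes "smooth_on f S" "z \<in> S"
  shows "hcov_fun H (\<lambda>w. a * (f w)\<^sup>2) k z = 2 * a * f z * hcov_fun H f k z"
  using assms
  by (simp add: hcov_fun_def delta_def power2_eq_square ddx_cmult ddx_mult ddy_cmult ddy_mult
      smooth_on_mult[OF S] sum_distrib_left algebra_simps)

lemma hcov_form_cong_open:
  assumes "\<And>j w. w \<in> S \<Longrightarrow> A j w = B j w" "\<And>i w. w \<in> S \<Longrightarrow> G i w = H i w" "z \<in> S"
  shows "hcov_form G A k m z = hcov_form H B k m z"
proof -
  have y: "ddy k (G i) w = ddy k (H i) w" if "w \<in> S" for i k w
    using that assms(2) by (auto intro: ddy_cong_open)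
  have "ddy j (ddy k (G i)) z = ddy j (ddy k (H i)) z" for i j k
    using assms(3) y by (auto intro: ddy_cong_open)
  moreover have "ddx j (A k) z = ddx j (B k) z" "ddy j (A k) z = ddy j (B k) z" for j k
    using assms by (auto intro: ddx_cong_open ddy_cong_open)
  ultimately show ?thesis
    using assms y by (simp add: hcov_form_def delta_def Ncoef_def berwald_def)
qed

lemma hcov_fun_cong_open:
  assumes "\<And>w. w \<in> S \<Longrightarrow> f w = g w" "\<And>i w. w \<in> S \<Longrightarrow> G i w = H i w" "z \<in> S"
  shows "hcov_fun G f k z = hcov_fun H g k z"
proof -
  have "ddy k (G i) z = ddy k (H i) z" for i k
    using assms by (auto intro: ddy_cong_open)
  moreover have "ddx j f z = ddx j g z" "ddy j f z = ddy j g z" for j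
    using assms by (auto intro: ddx_cong_open ddy_cong_open)
  ultimately show ?thesis
    by (simp add: hcov_fun_def delta_def Ncoef_def)
qed

text \<open>Here \<open>R\<^bsub>\<parallel>k\<^esub> = 2 a c f\<^sup>2 f\<^bsub>\<cdot>k\<^esub>\<close>, so \<open>R\<^bsub>\<parallel>m\<^esub> y\<^sup>m = 2 a c f\<^sup>3\<close> by Euler's identity. Its fibre
  derivative is three times \<open>R\<^bsub>\<parallel>k\<^esub>\<close>, hence \<open>R\<^bsub>\<cdot>k\<parallel>m\<^esub> y\<^sup>m\<close> is twice \<open>R\<^bsub>\<parallel>k\<^esub>\<close>.\<close>
lemma weyl_form_vanishes:
  assumes H: "\<And>i. smooth_on (H i) S" "\<And>i. homogeneous_on S 2 (H i)"
    and f: "smooth_on f S" "homogeneous_on S 1 f"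
    and par: "\<And>w k. w \<in> S \<Longrightarrow> hcov_fun H f k w = c * f w * ddy k f w"
    and R: "\<And>w. w \<in> S \<Longrightarrow> R w = a * (f w)\<^sup>2" and z: "z \<in> S"
  shows "hcov_fun H R k z - 1 / 2 * (\<Sum>m\<in>UNIV. hcov_form H (\<lambda>j. ddy j R) k m z * snd z $ m) = 0"
proof -
  have sR: "smooth_on R S"
    using smooth_on_cong[OF S R] f(1) by (simp add: smooth_on_cmult S smooth_on_mult power2_eq_square)
  have hR: "hcov_fun H R m w = 2 * a * c * (f w)\<^sup>2 * ddy m f w" if "w \<in> S" for m w
  proof -
    have "hcov_fun H R m w = hcov_fun H (\<lambda>w. a * (f w)\<^sup>2) m w"
      using that R by (intro hcov_fun_cong_open) auto
    then show ?thesis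
      using hcov_fun_cmult_square[OF f(1) that] par[OF that] by (simp add: power2_eq_square)
  qed
  have s2: "smooth_on (\<lambda>w. f w * f w) S" "smooth_on (\<lambda>w. f w * (f w * f w)) S"
    using f(1) by (intro smooth_on_mult S; assumption)+
  have "ddy k (\<lambda>w. \<Sum>m\<in>UNIV. snd w $ m * hcov_fun H R m w) z
      = ddy k (\<lambda>w. 2 * a * c * (f w * (f w * f w))) z"
  proof (rule ddy_cong_open[OF _ z])
    fix w assume w: "w \<in> S"
    have "(\<Sum>m\<in>UNIV. snd w $ m * hcov_fun H R m w)
        = 2 * a * c * (f w)\<^sup>2 * (\<Sum>m\<in>UNIV. snd w $ m * ddy m f w)"
      using hR[OF w] by (simp add: sum_distrib_left algebra_simps)
    then show "(\<Sum>m\<in>UNIV. snd w $ m * hcov_fun H R m w) = 2 * a * c * (f w * (f w * f w))"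
      using homogeneous_onD[OF f(2) w] by (simp add: power2_eq_square)
  qed
  also have "\<dots> = 6 * a * c * (f z)\<^sup>2 * ddy k f z"
    using f(1) z s2 by (subst ddy_cmult) (simp_all add: ddy_mult power2_eq_square algebra_simps)
  finally show ?thesis
    unfolding hcov_form_gradient_along_fibre[OF H sR z] hR[OF z] by simp
qed

end

section \<open>The spray of a Finsler metric\<close>

lemma matrix_vector_mult_positive_imp_invertible:
  fixes A :: "real ^ 'n ^ 'n::finite"
  assumes "\<And>u. u \<noteq> 0 \<Longrightarrow> u \<bullet> (A *v u) > 0"
  shows "invertible A"
proof -
  have "x = 0" if "A *v x = 0" for x
    using assms[of x] that by auto
  then show ?thesis
    using invertible_left_inverse matrix_left_invertible_ker by blast
qed

lemma matrix_mul_matrix_inv_right: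
  fixes A :: "real ^ 'n ^ 'n::finite"
  assumes "invertible A"
  shows "A ** matrix_inv A = mat 1"
  using someI_ex[OF assms[unfolded invertible_def]] by (simp add: matrix_inv_def)

text \<open>Up to the factor \<open>1/4\<close>, the covector that the fundamental tensor raises to the spray of \<open>F\<close>.\<close>
definition spray_covector :: "'n::finite lfun \<Rightarrow> 'n \<Rightarrow> 'n lfun" where
  "spray_covector F l = (\<lambda>z. (\<Sum>k\<in>UNIV. ddy l (ddx k (\<lambda>w. (F w)\<^sup>2)) z * snd z $ k) - ddx l (\<lambda>w. (F w)\<^sup>2) z)"

lemma finsler_spray_equation_vector:
  assumes "invertible (fundamental_tensor F z)"
  shows "fundamental_tensor F z *v (\<chi> i. finsler_spray F i z) = (\<chi> l. 1 / 4 * spray_covector F l z)"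
proof -
  let ?A = "fundamental_tensor F z"
  have "(\<chi> i. finsler_spray F i z) = matrix_inv ?A *v (\<chi> l. 1 / 4 * spray_covector F l z)"
    by (simp add: vec_eq_iff finsler_spray_def matrix_vector_mult_def sum_distrib_left spray_covector_def)
  then show ?thesis
    using matrix_mul_matrix_inv_right[OF assms]
    by (simp add: matrix_vector_mul_assoc)
qed

lemma finsler_spray_equation:
  assumes "invertible (fundamental_tensor F z)"
  shows "(\<Sum>i\<in>UNIV. ddy i (ddy l (\<lambda>w. (F w)\<^sup>2)) z * finsler_spray F i z) = 1 / 2 * spray_covector F l z"
proof -
  have "(fundamental_tensor F z *v (\<chi> i. finsler_spray F i z)) $ l = 1 / 4 * spray_covector F l z"
    using finsler_spray_equation_vector[OF assms] by simp
  then show ?thesis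
    by (simp add: matrix_vector_mult_def fundamental_tensor_def flip: sum_divide_distrib)
qed

context
  fixes S :: "((real ^ 'n::finite) \<times> (real ^ 'n)) set" and F :: "'n lfun"
  assumes S: "open S" and F: "smooth_on F S" "homogeneous_on S 1 F"
begin

abbreviation (input) Fsq where "Fsq \<equiv> \<lambda>w. (F w)\<^sup>2"

lemma smooth_on_Fsq: "smooth_on Fsq S"
  unfolding power2_eq_square by (intro smooth_on_mult S F)

lemma homogeneous_on_Fsq: "homogeneous_on S 2 Fsq"
  using homogeneous_on_mult[OF S F(1) F(1) F(2) F(2)] by (simp add: power2_eq_square)

lemma homogeneous_on_ddy_Fsq: "homogeneous_on S 1 (ddy i Fsq)"
  using homogeneous_on_ddy[OF S smooth_on_Fsq homogeneous_on_Fsq] by simp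

lemma homogeneous_on_ddy_ddy_Fsq: "homogeneous_on S 0 (ddy i (ddy j Fsq))"
  using homogeneous_on_ddy[OF S smooth_on_ddy[OF S smooth_on_Fsq] homogeneous_on_ddy_Fsq] by simp

text \<open>Euler's identity twice: \<open>F\<^sup>2\<close> has degree two and its fibre derivatives degree one. This is how
  positive definiteness yields \<open>F \<noteq> 0\<close>.\<close>
lemma Fsq_eq_fundamental_form:
  assumes z: "z \<in> S"
  shows "(F z)\<^sup>2 = snd z \<bullet> (fundamental_tensor F z *v snd z)"
proof -
  have "snd z \<bullet> (fundamental_tensor F z *v snd z)
      = 1 / 2 * (\<Sum>i\<in>UNIV. snd z $ i * (\<Sum>j\<in>UNIV. snd z $ j * ddy j (ddy i Fsq) z))"
    by (simp add: inner_vec_def matrix_vector_mult_def fundamental_tensor_def sum_distrib_left mult_ac)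
  also have "\<dots> = (F z)\<^sup>2"
    using homogeneous_onD[OF homogeneous_on_ddy_Fsq z] homogeneous_onD[OF homogeneous_on_Fsq z]
    by simp
  finally show ?thesis by simp
qed

lemma smooth_on_spray_covector: "smooth_on (spray_covector F l) S"
  unfolding spray_covector_def
  by (intro smooth_on_diff smooth_on_sum smooth_on_mult smooth_on_ddy smooth_on_ddx
      smooth_on_fibre_coordinate smooth_on_Fsq S)

lemma homogeneous_on_spray_covector: "homogeneous_on S 2 (spray_covector F l)"
proof -
  have h: "homogeneous_on S 2 (ddx k Fsq)" for k
    by (intro homogeneous_on_ddx S smooth_on_Fsq homogeneous_on_Fsq)
  have "homogeneous_on S (2 - 1 + 1) (\<lambda>z. ddy l (ddx k Fsq) z * snd z $ k)" for k
    by (intro homogeneous_on_mult homogeneous_on_ddy homogeneous_on_fibre_coordinate h S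
        smooth_on_ddy smooth_on_ddx smooth_on_Fsq smooth_on_fibre_coordinate)
  then have "homogeneous_on S 2 (\<lambda>z. ddy l (ddx k Fsq) z * snd z $ k)" for k
    by simp
  then show ?thesis
    unfolding spray_covector_def
    by (intro homogeneous_on_diff homogeneous_on_sum h S smooth_on_sum smooth_on_mult
        smooth_on_ddy smooth_on_ddx smooth_on_Fsq smooth_on_fibre_coordinate)
qed

context
  assumes inv: "\<And>z. z \<in> S \<Longrightarrow> invertible (fundamental_tensor F z)"
begin

text \<open>Cramer's rule writes the solution of the spray equation as a quotient of determinants.\<close>
lemma smooth_on_finsler_spray: "smooth_on (finsler_spray F k) S"
proof -
  let ?g = "\<lambda>i j z. 1 / 2 * ddy j (ddy i Fsq) z"
  let ?h = "\<lambda>i j z. if j = k then 1 / 4 * spray_covector F i z else ?g i j z"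
  have g: "smooth_on (?g i j) S" for i j
    by (intro smooth_on_cmult smooth_on_ddy smooth_on_Fsq S)
  have h: "smooth_on (?h i j) S" for i j
  proof (cases "j = k")
    case True
    then show ?thesis
      using smooth_on_cmult[OF S smooth_on_spray_covector, of "1 / 4" i] by simp
  next
    case False
    then show ?thesis
      using g[of j i] by simp
  qed
  have dnz: "det (\<chi> i j. ?g i j z) \<noteq> 0" if "z \<in> S" for z
    using inv[OF that] by (simp add: invertible_det_nz fundamental_tensor_def)
  have eq: "finsler_spray F k z = det (\<chi> i j. ?h i j z) * inverse (det (\<chi> i j. ?g i j z))"
    if z: "z \<in> S" for z
  proof -
    have "(\<chi> i. finsler_spray F i z) = (\<chi> k. det (\<chi> i j. if j = k
        then (\<chi> l. 1 / 4 * spray_covector F l z) $ i else fundamental_tensor F z $ i $ j)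
      / det (fundamental_tensor F z))"
      by (rule cramer[OF inv[OF z, unfolded invertible_det_nz], THEN iffD1,
            OF finsler_spray_equation_vector[OF inv[OF z]]])
    then have "finsler_spray F k z = det (\<chi> i j. if j = k
        then (\<chi> l. 1 / 4 * spray_covector F l z) $ i else fundamental_tensor F z $ i $ j)
      / det (fundamental_tensor F z)"
      by (simp add: vec_eq_iff)
    then show ?thesis
      by (simp only: fundamental_tensor_def vec_lambda_beta divide_inverse)
  qed
  have "smooth_on (\<lambda>z. det (\<chi> i j. ?h i j z) * inverse (det (\<chi> i j. ?g i j z))) S"
    using dnz by (intro smooth_on_mult smooth_on_inverse smooth_on_det g h S)
  then show ?thesis
    by (rule smooth_on_cong[OF S eq, THEN iffD2, rotated])
qed

text \<open>Apply the Euler operator to the spray equation. The coefficients have degree zero and the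
  right-hand side degree two, so the defect \<open>e\<^sup>i = y\<^sup>m \<partial>G\<^sup>i/\<partial>y\<^sup>m - 2 G\<^sup>i\<close> is in the kernel of the
  fundamental tensor.\<close>
lemma homogeneous_on_finsler_spray: "homogeneous_on S 2 (finsler_spray F i)"
  unfolding homogeneous_on_def
proof
  fix z assume z: "z \<in> S"
  let ?G = "finsler_spray F"
  define e where "e i = (\<Sum>m\<in>UNIV. snd z $ m * ddy m (?G i) z) - 2 * ?G i z" for i
  have "(\<Sum>i\<in>UNIV. ddy i (ddy l Fsq) z * e i) = 0" for l
  proof -
    have sm: "smooth_on (\<lambda>w. ddy i (ddy l Fsq) w * ?G i w) S" for i
      by (intro smooth_on_mult S smooth_on_ddy smooth_on_Fsq smooth_on_finsler_spray)
    have eq: "(\<Sum>i\<in>UNIV. ddy i (ddy l Fsq) w * ?G i w) = 1 / 2 * spray_covector F l w" if "w \<in> S" for w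
      by (rule finsler_spray_equation[OF inv[OF that]])
    have "homogeneous_on S 2 (\<lambda>w. 1 / 2 * spray_covector F l w)"
      by (intro homogeneous_on_cmult S smooth_on_spray_covector homogeneous_on_spray_covector)
    then have "homogeneous_on S 2 (\<lambda>w. \<Sum>i\<in>UNIV. ddy i (ddy l Fsq) w * ?G i w)"
      by (rule homogeneous_on_cong[OF S eq, THEN iffD2, rotated])
    from homogeneous_onD[OF this z]
    have "2 * (\<Sum>i\<in>UNIV. ddy i (ddy l Fsq) z * ?G i z)
        = (\<Sum>m\<in>UNIV. snd z $ m * ddy m (\<lambda>w. \<Sum>i\<in>UNIV. ddy i (ddy l Fsq) w * ?G i w) z)"
      by simp
    also have "\<dots> = (\<Sum>m\<in>UNIV. \<Sum>i\<in>UNIV. snd z $ m * (ddy i (ddy l Fsq) z * ddy m (?G i) z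
          + ddy m (ddy i (ddy l Fsq)) z * ?G i z))"
      using z sm by (simp add: ddy_sum[OF S] ddy_mult[OF S] smooth_on_ddy[OF S] smooth_on_Fsq
          smooth_on_finsler_spray sum_distrib_left)
    also have "\<dots> = (\<Sum>i\<in>UNIV. \<Sum>m\<in>UNIV. snd z $ m * (ddy i (ddy l Fsq) z * ddy m (?G i) z
          + ddy m (ddy i (ddy l Fsq)) z * ?G i z))"
      by (rule sum.swap)
    also have "\<dots> = (\<Sum>i\<in>UNIV. ddy i (ddy l Fsq) z * (\<Sum>m\<in>UNIV. snd z $ m * ddy m (?G i) z)
          + (\<Sum>m\<in>UNIV. snd z $ m * ddy m (ddy i (ddy l Fsq)) z) * ?G i z)"
      by (simp add: algebra_simps sum.distrib sum_distrib_left sum_distrib_right)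
    also have "\<dots> = (\<Sum>i\<in>UNIV. ddy i (ddy l Fsq) z * (\<Sum>m\<in>UNIV. snd z $ m * ddy m (?G i) z))"
      using homogeneous_onD[OF homogeneous_on_ddy_ddy_Fsq z] by simp
    finally show ?thesis
      by (simp add: e_def algebra_simps sum_subtractf sum_distrib_left)
  qed
  then have "fundamental_tensor F z *v (\<chi> i. e i) = 0"
    by (simp add: vec_eq_iff matrix_vector_mult_def fundamental_tensor_def flip: sum_divide_distrib)
  then have "(\<chi> i. e i) = 0"
    using inv[OF z] invertible_left_inverse matrix_left_invertible_ker by blast
  then show "(\<Sum>m\<in>UNIV. snd z $ m * ddy m (?G i) z) = 2 * ?G i z"
    by (simp add: vec_eq_iff e_def)
qed

text \<open>The contraction of the spray equation with \<open>y\<close>: \<open>F\<^sup>2\<close> is constant along the integral curves of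
  the spray.\<close>
lemma Fsq_constant_along_spray:
  assumes z: "z \<in> S"
  shows "(\<Sum>k\<in>UNIV. snd z $ k * ddx k Fsq z) = 2 * (\<Sum>i\<in>UNIV. ddy i Fsq z * finsler_spray F i z)"
proof -
  let ?G = "finsler_spray F"
  have "(\<Sum>l\<in>UNIV. snd z $ l * spray_covector F l z)
      = 2 * (\<Sum>l\<in>UNIV. snd z $ l * (\<Sum>i\<in>UNIV. ddy i (ddy l Fsq) z * ?G i z))"
    by (simp add: finsler_spray_equation[OF inv[OF z]] sum_distrib_left)
  also have "(\<Sum>l\<in>UNIV. snd z $ l * (\<Sum>i\<in>UNIV. ddy i (ddy l Fsq) z * ?G i z))
      = (\<Sum>l\<in>UNIV. \<Sum>i\<in>UNIV. snd z $ l * ddy l (ddy i Fsq) z * ?G i z)"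
    using ddy_ddy_commute[OF S smooth_on_Fsq z] by (simp add: sum_distrib_left mult.assoc)
  also have "\<dots> = (\<Sum>i\<in>UNIV. (\<Sum>l\<in>UNIV. snd z $ l * ddy l (ddy i Fsq) z) * ?G i z)"
    by (subst sum.swap) (simp add: sum_distrib_right)
  also have "\<dots> = (\<Sum>i\<in>UNIV. ddy i Fsq z * ?G i z)"
    using homogeneous_onD[OF homogeneous_on_ddy_Fsq z] by simp
  finally have 1: "(\<Sum>l\<in>UNIV. snd z $ l * spray_covector F l z) = 2 * (\<Sum>i\<in>UNIV. ddy i Fsq z * ?G i z)" .
  have "(\<Sum>l\<in>UNIV. snd z $ l * spray_covector F l z)
      = (\<Sum>l\<in>UNIV. \<Sum>k\<in>UNIV. snd z $ l * ddy l (ddx k Fsq) z * snd z $ k)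
        - (\<Sum>l\<in>UNIV. snd z $ l * ddx l Fsq z)"
    by (simp add: spray_covector_def algebra_simps sum_subtractf sum_distrib_left)
  also have "(\<Sum>l\<in>UNIV. \<Sum>k\<in>UNIV. snd z $ l * ddy l (ddx k Fsq) z * snd z $ k)
      = (\<Sum>k\<in>UNIV. (\<Sum>l\<in>UNIV. snd z $ l * ddy l (ddx k Fsq) z) * snd z $ k)"
    by (subst sum.swap) (simp add: sum_distrib_right)
  also have "\<dots> = 2 * (\<Sum>k\<in>UNIV. snd z $ k * ddx k Fsq z)"
    using homogeneous_onD[OF homogeneous_on_ddx[OF S smooth_on_Fsq homogeneous_on_Fsq] z]
    by (simp add: sum_distrib_left mult_ac)
  finally show ?thesis
    using 1 by simp
qed

text \<open>Differentiate \<open>[F\<^sup>2]\<^bsub>x\<^sup>k\<^esub> y\<^sup>k = 2 [F\<^sup>2]\<^bsub>y\<^sup>i\<^esub> G\<^sup>i\<close> by \<open>y\<^sup>j\<close>. The result contains the second fibre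
  derivatives of \<open>F\<^sup>2\<close> contracted with \<open>G\<close>; replacing these by the spray equation cancels the mixed
  derivatives and leaves \<open>[F\<^sup>2]\<^bsub>x\<^sup>j\<^esub> = N\<^sup>i\<^bsub>j\<^esub> [F\<^sup>2]\<^bsub>y\<^sup>i\<^esub>\<close>.\<close>
lemma hcov_fun_Fsq:
  assumes z: "z \<in> S"
  shows "hcov_fun (finsler_spray F) Fsq j z = 0"
proof -
  let ?G = "finsler_spray F"
  have sm: "smooth_on (\<lambda>w. ddy i Fsq w * ?G i w) S" for i
    by (intro smooth_on_mult S smooth_on_ddy smooth_on_Fsq smooth_on_finsler_spray)
  have arith: "2 * x = 2 * b" if "a + x = 2 * b + 2 * (1 / 2 * (a - x))" for a b x :: real
    using that by (simp add: field_simps)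
  have spray: "spray_covector F j z = (\<Sum>k\<in>UNIV. snd z $ k * ddy j (ddx k Fsq) z) - ddx j Fsq z"
    by (simp add: spray_covector_def mult.commute)
  have "(\<Sum>k\<in>UNIV. snd z $ k * ddy j (ddx k Fsq) z) + ddx j Fsq z
      = ddy j (\<lambda>w. \<Sum>k\<in>UNIV. snd w $ k * ddx k Fsq w) z"
    by (rule ddy_contraction[OF S smooth_on_ddx[OF S smooth_on_Fsq] z, symmetric])
  also have "\<dots> = ddy j (\<lambda>w. 2 * (\<Sum>i\<in>UNIV. ddy i Fsq w * ?G i w)) z"
    by (rule ddy_cong_open[OF S Fsq_constant_along_spray z])
  also have "\<dots> = 2 * (\<Sum>i\<in>UNIV. ddy i Fsq z * ddy j (?G i) z)
      + 2 * (\<Sum>i\<in>UNIV. ddy i (ddy j Fsq) z * ?G i z)"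
    using z sm ddy_ddy_commute[OF S smooth_on_Fsq z, of j]
    by (simp add: ddy_cmult[OF S] ddy_sum[OF S] ddy_mult[OF S] smooth_on_ddy[OF S] smooth_on_Fsq
        smooth_on_finsler_spray smooth_on_sum[OF S] sum.distrib)
  finally have "2 * ddx j Fsq z = 2 * (\<Sum>i\<in>UNIV. ddy i Fsq z * ddy j (?G i) z)"
    unfolding finsler_spray_equation[OF inv[OF z]] spray by (rule arith)
  then show ?thesis
    by (simp add: hcov_fun_def delta_def Ncoef_def mult.commute)
qed

end

end

section \<open>Homogeneity in the coordinates of a chart\<close>

text \<open>Euler's identity: compare the derivatives at \<open>s = 0\<close> of both sides of
  \<open>f (x, (1 + s) y) = (1 + s) f (x, y)\<close>.\<close>
lemma homogeneous_on_one_if_scaling: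
  fixes f :: "'n::finite lfun"
  assumes S: "open S" and f: "smooth_on f S"
    and scale: "\<And>x y a. (x, y) \<in> S \<Longrightarrow> a > 0 \<Longrightarrow> f (x, a *\<^sub>R y) = a * f (x, y)"
  shows "homogeneous_on S 1 f"
  unfolding homogeneous_on_def
proof
  fix z assume z: "z \<in> S"
  have d: "f differentiable (at z)"
    using smooth_on_differentiable[OF f z] .
  obtain x y where xy: "z = (x, y)" by (cases z)
  have "((\<lambda>s. f (z + s *\<^sub>R (0, y))) has_real_derivative dir_deriv (0, y) f z) (at 0)"
    using has_real_derivative_along_line[of f z 0 "(0, y)"] d by (simp del: scaleR_Pair)
  moreover have "((\<lambda>s. f (z + s *\<^sub>R (0, y))) has_real_derivative f z) (at 0)"
  proof (rule has_field_derivative_transform_within_open[of "\<lambda>s. (1 + s) * f z" _ _ "{-1<..}"])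
    show "((\<lambda>s. (1 + s) * f z) has_real_derivative f z) (at 0)"
      by (auto intro!: derivative_eq_intros)
    show "(1 + s) * f z = f (z + s *\<^sub>R (0, y))" if "s \<in> {-1<..}" for s
      using scale[of x y "1 + s"] that z xy by (simp add: scaleR_add_left)
  qed auto
  ultimately have "dir_deriv (0, y) f z = f z"
    by (rule DERIV_unique)
  moreover have "dir_deriv (0, y) f z = (\<Sum>l\<in>UNIV. y $ l * ddy l f z)"
  proof -
    have lin: "linear (frechet_derivative f (at z))"
      by (rule linear_frechet_derivative[OF d])
    have "(0, y) = (\<Sum>l\<in>UNIV. y $ l *\<^sub>R (0 :: real ^ 'n, axis l 1))"
      by (simp add: prod_eq_iff fst_sum snd_sum vec_eq_iff axis_def if_distrib cong: if_cong)
    then have "dir_deriv (0, y) f z = (\<Sum>l\<in>UNIV. dir_deriv (y $ l *\<^sub>R (0, axis l 1)) f z)"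
      by (simp only: linear_sum[OF lin] o_def)
    then show ?thesis
      by (simp add: linear_cmul[OF lin] ddy_def del: scaleR_Pair)
  qed
  ultimately show "(\<Sum>l\<in>UNIV. snd z $ l * ddy l f z) = 1 * f z"
    using xy by simp
qed

lemma chart_transition_differentiable:
  assumes "smooth_manifold M A" "c \<in> A" "d \<in> A" "p \<in> fst c \<inter> fst d"
  shows "(snd d \<circ> chart_inv c) differentiable (at (snd c p))"
proof -
  have "smooth_on (snd d \<circ> chart_inv c) (snd c ` (fst c \<inter> fst d))"
    using assms by (simp add: smooth_manifold_def)
  then show ?thesis
    using assms(4) by (intro smooth_on_differentiable) auto
qed

lemma chart_inj_on:
  assumes "smooth_manifold M A" "c \<in> A"
  shows "inj_on (snd c) (fst c)"
proof -
  have "openin M (fst c)" "homeomorphic_map (subtopology M (fst c)) (top_of_set (chart_image c)) (snd c)"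
    using assms by (auto simp: smooth_manifold_def)
  then show ?thesis
    using homeomorphic_imp_injective_map openin_subset by (metis topspace_subtopology_subset)
qed

lemma chart_overlap_open:
  assumes "smooth_manifold M A" "c \<in> A" "d \<in> A"
  shows "open (snd c ` (fst c \<inter> fst d))"
proof -
  have c: "openin M (fst c)" "openin M (fst d)" "open (chart_image c)"
    "open_map (subtopology M (fst c)) (top_of_set (chart_image c)) (snd c)"
    using assms unfolding smooth_manifold_def by (blast intro: homeomorphic_imp_open_map)+
  have "openin (subtopology M (fst c)) (fst c \<inter> fst d)"
    using openin_subtopology_Int[OF c(2), of "fst c"] by (simp add: Int_commute)
  then have "openin (top_of_set (chart_image c)) (snd c ` (fst c \<inter> fst d))"
    using c(4) by (simp add: open_map_def)
  then show ?thesis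
    using c(3) openin_open_eq by blast
qed

text \<open>The transformation law between the components in two charts \<open>d\<close> and \<open>e\<close> is the chain rule for
  the transition from \<open>c\<close> over \<open>d\<close> to \<open>e\<close>, which agrees with the direct transition on the overlap.\<close>
lemma coord_vector_in_tangent_space:
  assumes M: "smooth_manifold M A" and c: "c \<in> A" "p \<in> fst c"
  shows "coord_vector A c p y \<in> tangent_space A p"
proof -
  have "coord_vector A c p y e
      = frechet_derivative (snd e \<circ> chart_inv d) (at (snd d p)) (coord_vector A c p y d)"
    if d: "d \<in> A" "p \<in> fst d" and e: "e \<in> A" "p \<in> fst e" for d e
  proof -
    let ?x = "snd c p" and ?U = "snd c ` (fst c \<inter> fst d)"
    have inv_c: "chart_inv c (snd c q) = q" if "q \<in> fst c" for q
      using chart_inj_on[OF M c(1)] that by (simp add: chart_inv_def)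
    have inv_d: "chart_inv d (snd d q) = q" if "q \<in> fst d" for q
      using chart_inj_on[OF M d(1)] that by (simp add: chart_inv_def)
    have px: "(snd d \<circ> chart_inv c) ?x = snd d p"
      using inv_c[OF c(2)] by simp
    have D: "(snd d \<circ> chart_inv c) differentiable (at ?x)"
      "(snd e \<circ> chart_inv c) differentiable (at ?x)"
      "(snd e \<circ> chart_inv d) differentiable (at ((snd d \<circ> chart_inv c) ?x))"
      unfolding px using M c d e by (auto intro!: chart_transition_differentiable)
    have "frechet_derivative (snd e \<circ> chart_inv c) (at ?x)
        = frechet_derivative ((snd e \<circ> chart_inv d) \<circ> (snd d \<circ> chart_inv c)) (at ?x)"
    proof (rule frechet_derivative_transform_within_open[OF D(2) chart_overlap_open[OF M c(1) d(1)]])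
      show "?x \<in> ?U" using c d by auto
      show "(snd e \<circ> chart_inv c) x = ((snd e \<circ> chart_inv d) \<circ> (snd d \<circ> chart_inv c)) x"
        if "x \<in> ?U" for x
        using that inv_c inv_d by auto
    qed
    also have "\<dots> = frechet_derivative (snd e \<circ> chart_inv d) (at (snd d p))
        \<circ> frechet_derivative (snd d \<circ> chart_inv c) (at ?x)"
      using frechet_derivative_compose[OF D(1,3)] unfolding px .
    finally show ?thesis
      using d e by (simp add: coord_vector_def)
  qed
  moreover have "coord_vector A c p y d = 0" if "\<not> (d \<in> A \<and> p \<in> fst d)" for d
    unfolding coord_vector_def by (rule if_not_P[OF that])
  ultimately show ?thesis
    unfolding tangent_space_def by blast
qed

lemma coord_vector_scaleR:
  assumes M: "smooth_manifold M A" and c: "c \<in> A" "p \<in> fst c"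
  shows "coord_vector A c p (a *\<^sub>R y) = (\<lambda>d. a *\<^sub>R coord_vector A c p y d)"
proof
  fix d
  show "coord_vector A c p (a *\<^sub>R y) d = a *\<^sub>R coord_vector A c p y d"
    using linear_frechet_derivative[OF chart_transition_differentiable[OF M c(1), of d p]] c
    by (auto simp: coord_vector_def linear_cmul)
qed

lemma local_rep_scaling:
  assumes M: "smooth_manifold M A" and F: "finsler_metric M A F"
    and c: "c \<in> A" and x: "x \<in> chart_image c" and a: "a > 0"
  shows "local_rep A c F (x, a *\<^sub>R y) = a * local_rep A c F (x, y)"
proof -
  have p: "chart_inv c x \<in> fst c"
    using x by (simp add: chart_inv_def chart_image_def inv_into_into)
  then have "chart_inv c x \<in> topspace M"
    using M c unfolding smooth_manifold_def by blast
  then show ?thesis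
    using F a coord_vector_in_tangent_space[OF M c p, of y]
    by (simp add: local_rep_def coord_vector_scaleR[OF M c p] finsler_metric_def)
qed

section \<open>Vanishing of the Berwald-Weyl curvature\<close>

text \<open>The projective factor \<open>P = - c F\<close> is horizontally constant for the spray of \<open>F\<close>, so the Ricci
  scalar of the projective spray is \<open>(\<kappa> + c\<^sup>2) F\<^sup>2\<close>. The nonlinear connection of the projective spray
  differs from that of \<open>F\<close> by \<open>P\<^bsub>\<cdot>k\<^esub> y\<^sup>l\<close> and \<open>P\<close> times the identity, which contribute \<open>c F F\<^bsub>\<cdot>k\<^esub>\<close> each to the
  horizontal derivative of \<open>F\<close>.\<close>
theorem berwald_weyl_vanishes_in_chart:
  fixes F :: "'n::finite lfun" and \<sigma> :: "real ^ 'n \<Rightarrow> real"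
  assumes n: "CARD('n) \<ge> 2" and S: "open S" and F: "smooth_on F S" "homogeneous_on S 1 F"
    and slit: "\<And>z. z \<in> S \<Longrightarrow> snd z \<noteq> 0"
    and pos: "\<And>z u. z \<in> S \<Longrightarrow> u \<noteq> 0 \<Longrightarrow> u \<bullet> (fundamental_tensor F z *v u) > 0"
    and Ric: "\<And>z. z \<in> S \<Longrightarrow> ricci (finsler_spray F) z = (real CARD('n) - 1) * \<kappa> * (F z)\<^sup>2"
    and Scurv: "\<And>z. z \<in> S \<Longrightarrow> S_curvature (finsler_spray F) \<sigma> z = (real CARD('n) + 1) * c * F z"
    and z: "z \<in> S"
  shows "berwald_weyl (finsler_spray F) \<sigma> k z = 0"
proof -
  let ?G = "finsler_spray F"
  let ?P = "\<lambda>w. - c * F w"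
  let ?H = "\<lambda>i w. ?G i w + ?P w * snd w $ i"
  have inv: "invertible (fundamental_tensor F w)" if "w \<in> S" for w
    using pos[OF that] by (rule matrix_vector_mult_positive_imp_invertible)
  have G: "smooth_on (?G i) S" "homogeneous_on S 2 (?G i)" for i
    by (rule smooth_on_finsler_spray[OF S F], erule inv)
      (rule homogeneous_on_finsler_spray[OF S F], erule inv)
  have P: "smooth_on ?P S" "homogeneous_on S 1 ?P"
    by (intro smooth_on_cmult homogeneous_on_cmult S F)+
  have H: "smooth_on (?H i) S" "homogeneous_on S 2 (?H i)" for i
    by (rule smooth_on_projective_change[OF S G(1) P(1)],
        rule homogeneous_on_projective_change[OF S G(1) P(1) G(2) P(2)])
  have GF: "hcov_fun ?G F j w = 0" if w: "w \<in> S" for j w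
  proof -
    have "(F w)\<^sup>2 > 0"
      using pos[OF w slit[OF w]] Fsq_eq_fundamental_form[OF S F w] by simp
    moreover have "F w * hcov_fun ?G F j w = 0"
      using hcov_fun_cmult_square[OF S F(1) w, of ?G 1 j] hcov_fun_Fsq[OF S F inv w] by simp
    ultimately show ?thesis by auto
  qed
  have GP: "hcov_fun ?G ?P j w = 0" if w: "w \<in> S" for j w
  proof -
    have "hcov_fun ?G ?P j w = - c * hcov_fun ?G F j w"
      using ddx_cmult[OF S F(1) w, of _ "- c"] ddy_cmult[OF S F(1) w, of _ "- c"]
      by (simp add: hcov_fun_def delta_def sum_distrib_left algebra_simps)
    then show ?thesis using GF[OF w] by simp
  qed
  have contract: "(\<Sum>l\<in>UNIV. (N l + p * y l + (if l = j then q else 0)) * a l)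
      = (\<Sum>l\<in>UNIV. N l * a l) + p * (\<Sum>l\<in>UNIV. y l * a l) + q * a j"
    for N y a :: "'n \<Rightarrow> real" and p q j
  proof -
    have "(N l + p * y l + (if l = j then q else 0)) * a l
        = N l * a l + p * (y l * a l) + (if l = j then q * a l else 0)" for l
      by (simp add: algebra_simps)
    then show ?thesis
      by (simp add: sum.distrib sum_distrib_left)
  qed
  have par: "hcov_fun ?H F j w = 2 * c * F w * ddy j F w" if w: "w \<in> S" for j w
  proof -
    have "hcov_fun ?H F j w = hcov_fun ?G F j w - ddy j ?P w * (\<Sum>l\<in>UNIV. snd w $ l * ddy l F w)
        - ?P w * ddy j F w"
      unfolding hcov_fun_def delta_def Ncoef_def ddy_projective_change[OF S G(1) P(1) w] contract
      by simp
    then show ?thesis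
      using GF[OF w] homogeneous_onD[OF F(2) w] ddy_cmult[OF S F(1) w, of j "- c"] by simp
  qed
  \<comment> \<open>The S-curvature identifies the projective factor as \<open>- c F\<close>.\<close>
  have proj: "projective_spray ?G \<sigma> i w = ?H i w" if "w \<in> S" for i w
    using Scurv[OF that] by (simp add: projective_spray_def add_nonneg_eq_0_iff field_simps)
  have R: "ricci_scalar (projective_spray ?G \<sigma>) w = (\<kappa> + c\<^sup>2) * (F w)\<^sup>2" if w: "w \<in> S" for w
  proof -
    have "ricci (projective_spray ?G \<sigma>) w = ricci ?H w"
      using proj w by (intro ricci_cong_open[OF S])
    also have "\<dots> = (real CARD('n) - 1) * ((\<kappa> + c\<^sup>2) * (F w)\<^sup>2)"
      unfolding ricci_projective_change[OF S G P w] Ric[OF w] GP[OF w]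
      by (simp add: algebra_simps power2_eq_square)
    finally show ?thesis
      using n by (simp add: ricci_scalar_def)
  qed
  let ?R = "ricci_scalar (projective_spray ?G \<sigma>)"
  have "berwald_weyl ?G \<sigma> k z
      = hcov_fun ?H ?R k z - 1 / 2 * (\<Sum>m\<in>UNIV. hcov_form ?H (\<lambda>j. ddy j ?R) k m z * snd z $ m)"
    unfolding berwald_weyl_def Let_def
    using hcov_fun_cong_open[OF S refl proj z] hcov_form_cong_open[OF S refl proj z]
    by simp
  also have "\<dots> = 0"
    by (rule weyl_form_vanishes[OF S H F par R z])
  finally show ?thesis .
qed

theorem theorem1p5:
  fixes M :: "'a topology" and A :: "('a, 'n::finite) chart set"
    and F :: "'a \<Rightarrow> ('a, 'n) tvector \<Rightarrow> real"
  assumes "smooth_manifold M A" and "CARD('n) \<ge> 2"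
    and "finsler_metric M A F"
    and "constant_ricci_curvature A F"
    and "constant_S_curvature_BH A F"
  shows "\<forall>c\<in>A. \<forall>z\<in>slit c. \<forall>k.
    berwald_weyl (finsler_spray (local_rep A c F)) (sigma_BH (local_rep A c F)) k z = 0"
proof (intro ballI allI)
  fix c z k assume c: "c \<in> A" and z: "z \<in> slit c"
  let ?F = "local_rep A c F"
  obtain \<kappa> where Ric: "\<And>z. z \<in> slit c \<Longrightarrow>
      ricci (finsler_spray ?F) z = (real CARD('n) - 1) * \<kappa> * (?F z)\<^sup>2"
    using assms(4) c unfolding constant_ricci_curvature_def by blast
  obtain s where Scurv: "\<And>z. z \<in> slit c \<Longrightarrow>
      S_curvature (finsler_spray ?F) (sigma_BH ?F) z = (real CARD('n) + 1) * s * ?F z"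
    using assms(5) c unfolding constant_S_curvature_BH_def by blast
  have "open (chart_image c)"
    using assms(1) c by (simp add: smooth_manifold_def)
  then have S: "open (slit c)"
    unfolding slit_def by (intro open_Times open_Diff) auto
  have F: "smooth_on ?F (slit c)"
    using assms(3) c by (simp add: finsler_metric_def)
  have hF: "homogeneous_on (slit c) 1 ?F"
    using local_rep_scaling[OF assms(1,3) c]
    by (intro homogeneous_on_one_if_scaling S F) (auto simp: slit_def)
  have pos: "u \<bullet> (fundamental_tensor ?F w *v u) > 0" if "w \<in> slit c" "u \<noteq> 0" for w u
    using assms(3) c that by (simp add: finsler_metric_def)
  show "berwald_weyl (finsler_spray ?F) (sigma_BH ?F) k z = 0"
    by (rule berwald_weyl_vanishes_in_chart[OF assms(2) S F hF _ pos Ric Scurv z])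
      (auto simp: slit_def)
qed

end
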